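(* Let $r\ge1$ be an integer, $a>0$, $w_1,\dots,w_r>0$ real, and let $r-1<\sigma_1<\sigma_2$ and $C>1$. Then for $x\ge 1$ and every $s=\sigma+it\in\mathbb{C}$ with $\sigma_1<\sigma<\sigma_2$ and $|t|\le 2\pi x/C$, \[ \zeta_r(s,a,\mathbf{w})=\sum_{0\le m_1\le x}\cdots\sum_{0\le m_r\le x}\frac{1}{(a+\mathbf{m}\cdot\mathbf{w})^{s}} -\sum_{\substack{I\subseteq\{1,\dots,r\}\\ I\neq\emptyset}}(-1)^{\# I}\,\frac{\bigl(a+x\sum_{i\in I}w_i\bigr)^{r-s}}{(s-1)(s-2)\cdots(s-r)\,w_1\cdots w_r}+O(x^{r-1-\sigma}) \] as $x\to\infty$ (the $m_i$ run over integers).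
   Context: For $\mathbf{m}=(m_1,\dots,m_r)\in\mathbb{Z}_{\ge0}^r$ write $\mathbf{m}\cdot\mathbf{w}=m_1w_1+\cdots+m_rw_r$. The Barnes multiple zeta function is \[ \zeta_r(s,a,\mathbf{w})=\sum_{m_1,\dots,m_r\ge 0}\frac{1}{(a+\mathbf{m}\cdot\mathbf{w})^s}, \] absolutely convergent for $\mathrm{Re}(s)>r$ and meromorphically continued to $\mathbb{C}$ (simple poles at $s=1,\dots,r$). Complex powers use the principal branch (bases are positive reals). The implied constant may depend on $r,a,\mathbf{w},\sigma_1,\sigma_2,C$ but not on $x$ or $t$. *)

theory Defs
  imports "HOL-Analysis.Analysis"
begin

text \<open>Index vectors (m_0,...,m_{r-1}) in Z_{>=0}^r, encoded as functions nat => nat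
  vanishing from index r on.\<close>
definition barnes_idx :: "nat \<Rightarrow> (nat \<Rightarrow> nat) set" where
  "barnes_idx r = {m. \<forall>i\<ge>r. m i = 0}"

definition barnes_lin :: "nat \<Rightarrow> (nat \<Rightarrow> real) \<Rightarrow> (nat \<Rightarrow> nat) \<Rightarrow> real" where
  "barnes_lin r w m = (\<Sum>i<r. real (m i) * w i)"

definition barnes_series :: "nat \<Rightarrow> real \<Rightarrow> (nat \<Rightarrow> real) \<Rightarrow> complex \<Rightarrow> complex" where
  "barnes_series r a w s =
     (\<Sum>\<^sub>\<infinity> m \<in> barnes_idx r. 1 / (complex_of_real (a + barnes_lin r w m) powr s))"

definition barnes_poles :: "nat \<Rightarrow> complex set" where
  "barnes_poles r = {of_nat k | k. 1 \<le> k \<and> k \<le> r}"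

text \<open>Barnes multiple zeta function: the meromorphic continuation of the series,
  i.e. the (unique) function holomorphic off the poles s = 1..r that agrees with the
  series for Re s > r; at the poles themselves it is set to 0 by convention.\<close>
definition barnes_zeta :: "nat \<Rightarrow> real \<Rightarrow> (nat \<Rightarrow> real) \<Rightarrow> complex \<Rightarrow> complex" where
  "barnes_zeta r a w = (THE f. f holomorphic_on (- barnes_poles r)
      \<and> (\<forall>s. Re s > real r \<longrightarrow> f s = barnes_series r a w s)
      \<and> (\<forall>s\<in>barnes_poles r. f s = 0))"

end

theory Submission
  imports Defs "HOL-Complex_Analysis.Complex_Analysis"
begin

text \<open>
  Write \<open>\<zeta>(y)\<close> for the Barnes zeta function with parameter \<open>y\<close>, and \<open>M(y)\<close> for the main term
  \<open>y\<^bsup>r-s\<^esup> / ((s-1)\<cdots>(s-r) w\<^sub>1\<cdots>w\<^sub>r)\<close>. Inclusion-exclusion over the faces of the box with \<open>N = \<lfloor>x\<rfloor> + 1\<close>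
  lattice points per side gives the exact identity
  \<open>\<zeta>(a) - box = - \<Sum>\<^bsub>I \<noteq> {}\<^esub> (-1)\<^bsup>|I|\<^esup> \<zeta>(a + N \<Sum>\<^bsub>i\<in>I\<^esub> w\<^sub>i)\<close>, so it suffices to show
  \<open>\<zeta>(y) = M(y) + O(y\<^bsup>r-1-\<sigma>\<^esup>)\<close> whenever \<open>|t| w\<^sub>i \<le> 2 \<pi> y / C\<close> for at least one \<open>i\<close>.

  In one variable, the sum of \<open>(y + n v)\<^bsup>-s\<^esup>\<close> over \<open>n\<close> is compared with its integral by the explicit primitive
  \<open>y\<^bsup>-s\<^esup> Q(-\<i> t v / y)\<close>, \<open>Q(z) = 1/(1 - e\<^bsup>z\<^esup>) + 1/z\<close>: its difference with step \<open>v\<close> matches the term of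
  the sum minus the integral up to a relative error \<open>O(1/y)\<close>, because \<open>Q\<close> is smooth for \<open>|z| < 2 \<pi>\<close>. If
  all frequencies \<open>|t| w\<^sub>i / y\<close> are at most \<open>\<pi>\<close>, replacing one sum after the other by an integral gives
  the claim. Otherwise \<open>|t|\<close> is of order \<open>y\<close>, so \<open>M\<close> is itself within the error term; a box of side of
  order \<open>y\<close> is split off, whose sum is bounded by the one-dimensional estimate in the direction \<open>i\<close> and
  trivially in the other directions, and whose remaining shifts have low frequency.

  The continuation itself comes from the Taylor expansion of \<open>(Y + v)\<^bsup>1-s\<^esup>\<close> in \<open>v\<close>: summed over all index
  vectors it expresses \<open>\<zeta>\<close> at \<open>s\<close> by its values further to the right and the function of rank \<open>r - 1\<close>.
\<close>

section \<open>Sums over index vectors\<close>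

lemma norm_of_real_powr:
  "y > 0 \<Longrightarrow> norm (complex_of_real y powr z) = y powr Re z"
  by (simp add: norm_powr_real_powr)

lemma barnes_lin_nonneg:
  "\<forall>i<r. w i > 0 \<Longrightarrow> barnes_lin r w m \<ge> 0"
  unfolding barnes_lin_def by (intro sum_nonneg) (simp add: less_imp_le)

lemma barnes_lin_upd:
  "barnes_lin (Suc r) w (m(r := n)) = barnes_lin r w m + real n * w r"
  unfolding barnes_lin_def by simp

lemma barnes_idx_0: "barnes_idx 0 = {\<lambda>_. 0}"
  unfolding barnes_idx_def by auto

lemma bij_betw_barnes_idx_Suc:
  "bij_betw (\<lambda>(m, n). m(r := n)) (barnes_idx r \<times> UNIV) (barnes_idx (Suc r))"
  by (rule bij_betwI[where g = "\<lambda>m. (m(r := 0), m r)"])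
     (auto simp: barnes_idx_def fun_eq_iff)

text \<open>By the mean value theorem each term is at most a constant times the drop of
  \<open>Y powr (1 - p)\<close> over the step from \<open>Y\<close> to \<open>Y + v\<close>, so the
  partial sums telescope. The constant is uniform in \<open>y\<close> and \<open>p\<close>, which
  all later estimates rely on.\<close>

lemma powr_sum_bound:
  fixes v y0 p0 p1 :: real
  assumes v: "v > 0" and y0: "y0 > 0" and p0: "1 < p0"
  shows "\<exists>K\<ge>0. \<forall>y\<ge>y0. \<forall>p. p0 \<le> p \<longrightarrow> p \<le> p1 \<longrightarrow>
           (\<lambda>n. (y + real n * v) powr (-p)) summable_on UNIV \<and>
           (\<Sum>\<^sub>\<infinity>n. (y + real n * v) powr (-p)) \<le> K * y powr (1 - p)"
proof -
  \<comment> \<open>The factor \<open>(1 + v / y0) powr p1\<close> pays for moving the derivative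
    from the intermediate point back to \<open>Y\<close>; \<open>p0 - 1\<close> is the least
    possible value of \<open>p - 1\<close>.\<close>
  define K where "K = (1 + v / y0) powr p1 / ((p0 - 1) * v)"
  have Kpos: "K > 0" using assms by (auto simp: K_def add_pos_pos less_imp_neq[symmetric])
  have step: "Y powr (-p) \<le> K * (Y powr (1 - p) - (Y + v) powr (1 - p))"
    if "Y \<ge> y0" "p0 \<le> p" "p \<le> p1" for Y p
  proof -
    have Y: "Y > 0" using that y0 by simp
    have "\<exists>z>Y. z < Y + v \<and> (Y + v) powr (1 - p) - Y powr (1 - p)
            = (Y + v - Y) * ((1 - p) * z powr (1 - p - 1))"
      using Y v by (intro MVT2) (auto intro!: derivative_eq_intros simp: has_real_derivative_powr)
    then obtain z where z: "z > Y" "z < Y + v"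
      "(Y + v) powr (1 - p) - Y powr (1 - p) = v * ((1 - p) * z powr (-p))" by auto
    have A: "Y + v \<le> (1 + v / y0) * Y"
      using that y0 v by (simp add: field_simps)
    have B: "1 + v / y0 \<ge> 1" using v y0 by simp
    have "z powr (-p) \<ge> ((1 + v / y0) * Y) powr (-p)"
      using z A Y that p0 by (intro powr_mono2') auto
    also have "((1 + v / y0) * Y) powr (-p) = (1 + v / y0) powr (-p) * Y powr (-p)"
      by (simp add: powr_mult)
    also have "\<dots> \<ge> (1 + v / y0) powr (-p1) * Y powr (-p)"
      using B that by (intro mult_right_mono powr_mono) auto
    finally have C: "(1 + v / y0) powr (-p1) * Y powr (-p) \<le> z powr (-p)" .
    have "Y powr (-p) = K * (v * ((p0 - 1) * ((1 + v / y0) powr (-p1) * Y powr (-p))))"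
    proof -
      have "K * (v * (p0 - 1)) * (1 + v / y0) powr (-p1) = 1"
        using v p0 B by (simp add: K_def powr_minus)
      then show ?thesis by (metis mult.assoc mult_1)
    qed
    also have "\<dots> \<le> K * (v * ((p - 1) * (z powr (-p))))"
      using C Kpos v that p0 by (intro mult_left_mono mult_mono) auto
    also have "\<dots> = K * (Y powr (1 - p) - (Y + v) powr (1 - p))"
    proof -
      have "v * ((p - 1) * z powr (-p)) = Y powr (1 - p) - (Y + v) powr (1 - p)"
        using z(3) by (simp add: algebra_simps)
      then show ?thesis by simp
    qed
    finally show ?thesis .
  qed
  show ?thesis
  proof (intro exI[of _ K] conjI allI impI)
    fix y p assume y: "y \<ge> y0" and p: "p0 \<le> p" "p \<le> p1"
    define f where "f = (\<lambda>n. (y + real n * v) powr (-p))"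
    have part: "sum f {..<N} \<le> K * (y powr (1 - p) - (y + real N * v) powr (1 - p))" for N
    proof (induction N)
      case (Suc N)
      have "f N \<le> K * ((y + real N * v) powr (1 - p) - (y + real N * v + v) powr (1 - p))"
        unfolding f_def using y p v by (intro step) (auto intro: add_increasing2)
      with Suc show ?case by (simp add: algebra_simps)
    qed simp
    have part': "sum f {..<N} \<le> K * y powr (1 - p)" for N
      using part[of N] Kpos by (smt (verit) mult_left_mono powr_ge_zero)
    have s: "summable f" by (rule summableI_nonneg_bounded[OF _ part']) (simp add: f_def)
    have so: "f summable_on UNIV"
      by (rule summable_nonneg_imp_summable_on[OF s]) (simp add: f_def)
    have "infsum f UNIV = suminf f"
      using so has_sum_imp_sums has_sum_infsum sums_unique by blast
    moreover have "suminf f \<le> K * y powr (1 - p)"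
      by (rule suminf_le_const[OF s part'])
    ultimately show "(\<lambda>n. (y + real n * v) powr (-p)) summable_on UNIV"
      "(\<Sum>\<^sub>\<infinity>n. (y + real n * v) powr (-p)) \<le> K * y powr (1 - p)"
      using so by (auto simp: f_def)
  qed (use Kpos in simp)
qed

text \<open>Summing out the last index lowers both the rank and the exponent by one, so the
  one-variable bound iterates.\<close>

lemma barnes_powr_sum_bound:
  fixes y0 p0 p1 :: real
  assumes w: "\<forall>i<r. w i > 0" and y0: "y0 > 0" and p0: "real r < p0"
  shows "\<exists>K\<ge>0. \<forall>y\<ge>y0. \<forall>p. p0 \<le> p \<longrightarrow> p \<le> p1 \<longrightarrow>
           (\<lambda>m. (y + barnes_lin r w m) powr (-p)) summable_on barnes_idx r \<and>
           (\<Sum>\<^sub>\<infinity>m\<in>barnes_idx r. (y + barnes_lin r w m) powr (-p)) \<le> K * y powr (real r - p)"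
  using w p0
proof (induction r arbitrary: p0 p1)
  case 0
  then show ?case by (intro exI[of _ 1]) (auto simp: barnes_idx_0 barnes_lin_def)
next
  case (Suc r)
  have w': "\<forall>i<r. w i > 0" and v: "w r > 0" using Suc.prems by auto
  obtain K1 where K1: "K1 \<ge> 0" and K1b: "\<And>y p. y \<ge> y0 \<Longrightarrow> p0 \<le> p \<Longrightarrow> p \<le> p1 \<Longrightarrow>
           (\<lambda>n. (y + real n * w r) powr (-p)) summable_on UNIV \<and>
           (\<Sum>\<^sub>\<infinity>n. (y + real n * w r) powr (-p)) \<le> K1 * y powr (1 - p)"
    using powr_sum_bound[OF v y0, of p0 p1] Suc.prems by fastforce
  obtain K2 where K2: "K2 \<ge> 0" and K2b: "\<And>y p. y \<ge> y0 \<Longrightarrow> p0 - 1 \<le> p \<Longrightarrow> p \<le> p1 - 1 \<Longrightarrow>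
           (\<lambda>m. (y + barnes_lin r w m) powr (-p)) summable_on barnes_idx r \<and>
           (\<Sum>\<^sub>\<infinity>m\<in>barnes_idx r. (y + barnes_lin r w m) powr (-p)) \<le> K2 * y powr (real r - p)"
    using Suc.IH[of "p0 - 1" "p1 - 1"] w' Suc.prems by auto
  show ?case
  proof (intro exI[of _ "K1 * K2"] conjI allI impI)
    fix y p assume y: "y \<ge> y0" and p: "p0 \<le> p" "p \<le> p1"
    define f where "f = (\<lambda>m. (y + barnes_lin (Suc r) w m) powr (-p))"
    define g where "g = (\<lambda>(m, n). f (m(r := n)))"
    have g: "g (m, n) = (y + barnes_lin r w m + real n * w r) powr (-p)" for m n
      by (simp add: g_def f_def barnes_lin_upd add.assoc)
    have Y: "y + barnes_lin r w m \<ge> y0" for m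
      using y barnes_lin_nonneg[OF w', of m] by simp
    have in1: "(\<lambda>n. g (m, n)) summable_on UNIV" and
         in2: "(\<Sum>\<^sub>\<infinity>n. g (m, n)) \<le> K1 * (y + barnes_lin r w m) powr (1 - p)" for m
      using K1b[OF Y p] by (simp_all add: g)
    have out1: "(\<lambda>m. (y + barnes_lin r w m) powr (1 - p)) summable_on barnes_idx r" and
         out2: "(\<Sum>\<^sub>\<infinity>m\<in>barnes_idx r. (y + barnes_lin r w m) powr (1 - p)) \<le> K2 * y powr (real r - (p - 1))"
      using K2b[OF y, of "p - 1"] p by simp_all
    have nn: "(\<Sum>\<^sub>\<infinity>n. g (m, n)) \<ge> 0" for m by (rule infsum_nonneg) (simp add: g)
    have out: "(\<lambda>m. \<Sum>\<^sub>\<infinity>n. g (m, n)) summable_on barnes_idx r"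
      by (rule summable_on_comparison_test[OF summable_on_cmult_right[OF out1, of K1] in2 nn])
    \<comment> \<open>The terms are nonnegative, so iterated summability already gives summability
      over the product, and the order of summation is free.\<close>
    have gs: "g summable_on (barnes_idx r \<times> UNIV)"
    proof -
      have "(\<lambda>q. norm (g q)) summable_on (barnes_idx r \<times> UNIV)"
        by (rule Infinite_Sum.abs_summable_on_Sigma_iff[THEN iffD2]) (use in1 out nn in \<open>auto simp: g\<close>)
      then show ?thesis by (rule abs_summable_summable)
    qed
    have eq: "g = (\<lambda>q. f ((\<lambda>(m, n). m(r := n)) q))" by (auto simp: g_def)
    show "(\<lambda>m. (y + barnes_lin (Suc r) w m) powr (-p)) summable_on barnes_idx (Suc r)"
      using gs summable_on_reindex_bij_betw[OF bij_betw_barnes_idx_Suc[of r], of f]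
      unfolding eq f_def by simp
    have "infsum f (barnes_idx (Suc r)) = infsum g (barnes_idx r \<times> UNIV)"
      unfolding eq by (rule infsum_reindex_bij_betw[OF bij_betw_barnes_idx_Suc[of r], symmetric])
    also have "\<dots> = (\<Sum>\<^sub>\<infinity>m\<in>barnes_idx r. \<Sum>\<^sub>\<infinity>n. g (m, n))"
      by (rule infsum_Sigma_banach[OF gs, symmetric])
    also have "\<dots> \<le> (\<Sum>\<^sub>\<infinity>m\<in>barnes_idx r. K1 * (y + barnes_lin r w m) powr (1 - p))"
      by (intro infsum_mono out summable_on_cmult_right out1 in2)
    also have "\<dots> = K1 * (\<Sum>\<^sub>\<infinity>m\<in>barnes_idx r. (y + barnes_lin r w m) powr (1 - p))"
      by (rule infsum_cmult_right) (simp add: out1)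
    also have "\<dots> \<le> K1 * (K2 * y powr (real r - (p - 1)))"
      by (intro mult_left_mono out2 K1)
    finally show "(\<Sum>\<^sub>\<infinity>m\<in>barnes_idx (Suc r). (y + barnes_lin (Suc r) w m) powr (-p))
         \<le> K1 * K2 * y powr (real (Suc r) - p)"
      by (simp add: f_def algebra_simps)
  qed (use K1 K2 in simp)
qed

lemma barnes_powr_summable:
  assumes "\<forall>i<r. w i > 0" and "y > 0" and "real r < p"
  shows "(\<lambda>m. (y + barnes_lin r w m) powr (-p)) summable_on barnes_idx r"
  using barnes_powr_sum_bound[OF assms, of p] by blast

lemma barnes_dominated_abs_summable:
  fixes f :: "real \<Rightarrow> complex"
  assumes w: "\<forall>i<r. w i > 0" and y: "y > 0" and p: "real r < p"
    and f: "\<And>Y. Y \<ge> y \<Longrightarrow> norm (f Y) \<le> B * Y powr (-p)"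
  shows "(\<lambda>m. norm (f (y + barnes_lin r w m))) summable_on barnes_idx r"
proof (rule summable_on_comparison_test)
  show "(\<lambda>m. B * (y + barnes_lin r w m) powr (-p)) summable_on barnes_idx r"
    by (intro summable_on_cmult_right barnes_powr_summable w y p)
qed (use barnes_lin_nonneg[OF w] f in auto)

lemma barnes_dominated_summable:
  fixes f :: "real \<Rightarrow> complex"
  assumes w: "\<forall>i<r. w i > 0" and y: "y > 0" and p: "real r < p"
    and f: "\<And>Y. Y \<ge> y \<Longrightarrow> norm (f Y) \<le> B * Y powr (-p)"
  shows "(\<lambda>m. f (y + barnes_lin r w m)) summable_on barnes_idx r"
  by (rule abs_summable_summable[OF barnes_dominated_abs_summable[OF assms]])

text \<open>Fubini along the bijection that appends the last coordinate. The inner sums run in the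
  single direction \<open>w r\<close>, where the one-variable estimates apply.\<close>

lemma barnes_sum_Suc:
  fixes f :: "real \<Rightarrow> complex"
  assumes "(\<lambda>m. f (y + barnes_lin (Suc r) w m)) summable_on barnes_idx (Suc r)"
  shows "(\<Sum>\<^sub>\<infinity>m\<in>barnes_idx (Suc r). f (y + barnes_lin (Suc r) w m)) =
         (\<Sum>\<^sub>\<infinity>m\<in>barnes_idx r. \<Sum>\<^sub>\<infinity>n. f (y + barnes_lin r w m + real n * w r))" (is "?A = ?B")
    and "(\<lambda>m. \<Sum>\<^sub>\<infinity>n. f (y + barnes_lin r w m + real n * w r)) summable_on barnes_idx r" (is ?C)
    and "m \<in> barnes_idx r \<Longrightarrow>
         (\<lambda>n. f (y + barnes_lin r w m + real n * w r)) summable_on UNIV" (is "_ \<Longrightarrow> ?D")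
proof -
  define h where "h = (\<lambda>m. f (y + barnes_lin (Suc r) w m))"
  define g where "g = (\<lambda>m n. f (y + barnes_lin r w m + real n * w r))"
  have eq: "(\<lambda>(m, n). g m n) = (\<lambda>q. h ((\<lambda>(m, n). m(r := n)) q))"
    by (auto simp: g_def h_def barnes_lin_upd add.assoc)
  have gs: "(\<lambda>(m, n). g m n) summable_on (barnes_idx r \<times> UNIV)"
    using assms unfolding eq summable_on_reindex_bij_betw[OF bij_betw_barnes_idx_Suc[of r], of h]
    by (simp add: h_def)
  have "?A = infsum (\<lambda>(m, n). g m n) (barnes_idx r \<times> UNIV)"
    using infsum_reindex_bij_betw[OF bij_betw_barnes_idx_Suc[of r], of h]
    unfolding eq h_def by simp
  then show "?A = ?B"
    using infsum_Sigma'_banach[OF gs] by (simp add: g_def)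
  show ?C
    using summable_on_Sigma_banach[OF gs] by (simp add: g_def)
  show ?D if "m \<in> barnes_idx r"
    using summable_on_SigmaD1[OF gs that] by (simp add: g_def)
qed

text \<open>The Weierstrass test on small closed discs makes the finite partial sums converge
  uniformly, and a uniform limit of holomorphic functions is holomorphic.\<close>

lemma barnes_sum_holomorphic:
  fixes f :: "real \<Rightarrow> complex \<Rightarrow> complex"
  assumes w: "\<forall>i<r. w i > 0" and y: "y > 0" and U: "open U"
    and hol: "\<And>Y. Y \<ge> y \<Longrightarrow> f Y holomorphic_on U"
    and dom: "\<And>s0. s0 \<in> U \<Longrightarrow> \<exists>d>0. \<exists>p>real r. \<exists>B. \<forall>Y\<ge>y. \<forall>s\<in>cball s0 d.
                 norm (f Y s) \<le> B * Y powr (-p)"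
  shows "(\<lambda>s. \<Sum>\<^sub>\<infinity>m\<in>barnes_idx r. f (y + barnes_lin r w m) s) holomorphic_on U"
  unfolding holomorphic_on_def
proof
  fix s0 assume s0: "s0 \<in> U"
  obtain d p B where d: "d > 0" and p: "p > real r"
    and B: "\<And>Y s. Y \<ge> y \<Longrightarrow> s \<in> cball s0 d \<Longrightarrow> norm (f Y s) \<le> B * Y powr (-p)"
    using dom[OF s0] by blast
  obtain e where e: "e > 0" "cball s0 e \<subseteq> U" using U s0 open_contains_cball by blast
  define \<rho> where "\<rho> = min d e"
  have \<rho>: "\<rho> > 0" "cball s0 \<rho> \<subseteq> U" "cball s0 \<rho> \<subseteq> cball s0 d"
    using d e by (auto simp: \<rho>_def)
  have Y: "y + barnes_lin r w m \<ge> y" for m using barnes_lin_nonneg[OF w, of m] by simp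
  have lim: "uniform_limit (cball s0 \<rho>) (\<lambda>X s. \<Sum>m\<in>X. f (y + barnes_lin r w m) s)
      (\<lambda>s. \<Sum>\<^sub>\<infinity>m\<in>barnes_idx r. f (y + barnes_lin r w m) s) (finite_subsets_at_top (barnes_idx r))"
  proof (rule Weierstrass_m_test_general)
    show "(\<lambda>m. B * (y + barnes_lin r w m) powr (-p)) summable_on barnes_idx r"
      by (intro summable_on_cmult_right barnes_powr_summable w y p)
  qed (use B[OF Y] \<rho> in auto)
  have ev: "\<forall>X. continuous_on (cball s0 \<rho>) (\<lambda>s. \<Sum>m\<in>X. f (y + barnes_lin r w m) s) \<and>
     (\<lambda>s. \<Sum>m\<in>X. f (y + barnes_lin r w m) s) holomorphic_on ball s0 \<rho>"
  proof (intro allI conjI)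
    fix X
    have h: "(\<lambda>s. \<Sum>m\<in>X. f (y + barnes_lin r w m) s) holomorphic_on U"
      by (intro holomorphic_on_sum hol Y)
    show "continuous_on (cball s0 \<rho>) (\<lambda>s. \<Sum>m\<in>X. f (y + barnes_lin r w m) s)"
      using h \<rho>(2) holomorphic_on_imp_continuous_on holomorphic_on_subset by blast
    show "(\<lambda>s. \<Sum>m\<in>X. f (y + barnes_lin r w m) s) holomorphic_on ball s0 \<rho>"
      using h \<rho>(2) ball_subset_cball holomorphic_on_subset by blast
  qed
  have "(\<lambda>s. \<Sum>\<^sub>\<infinity>m\<in>barnes_idx r. f (y + barnes_lin r w m) s) holomorphic_on ball s0 \<rho>"
    using holomorphic_uniform_limit[OF always_eventually[OF ev] lim] by auto
  then show "(\<lambda>s. \<Sum>\<^sub>\<infinity>m\<in>barnes_idx r. f (y + barnes_lin r w m) s) field_differentiable at s0 within U"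
    using \<rho>(1) by (metis centre_in_ball field_differentiable_at_within
      holomorphic_on_imp_differentiable_at open_ball)
qed

section \<open>Analytic continuation\<close>

text \<open>Gives bounds uniform in the exponent without deciding whether the base is below or above
  1.\<close>

lemma powr_le_endpoints:
  fixes y :: real
  assumes "y > 0" "a \<le> e" "e \<le> b"
  shows "y powr e \<le> y powr a + y powr b"
proof (cases "y \<ge> 1")
  case True
  then have "y powr e \<le> y powr b" using assms by (intro powr_mono) auto
  then show ?thesis by (simp add: add_increasing)
next
  case False
  then have "y powr e \<le> y powr a" using assms by (intro powr_mono') auto
  then show ?thesis by (simp add: add_increasing2)
qed

lemma powr_shift_le:
  fixes y :: real
  assumes "y > 0" "Y \<ge> y" "p \<le> q" "q \<le> p + D"
  shows "Y powr (-q) \<le> (1 + y powr (-D)) * Y powr (-p)"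
proof -
  have "Y powr (-q) = Y powr (p - q) * Y powr (-p)" by (simp flip: powr_add)
  also have "Y powr (p - q) \<le> y powr (p - q)" using assms by (intro powr_mono2') auto
  also have "y powr (p - q) \<le> y powr (-D) + y powr 0"
    using assms by (intro powr_le_endpoints) auto
  finally show ?thesis using assms by (simp add: mult_right_mono add.commute)
qed

text \<open>The form in which holomorphy is used: a decay rate that moves with \<open>Re s\<close>,
  with constants uniform on bounded sets of \<open>s\<close>, yields the local domination by a fixed
  power.\<close>

lemma barnes_sum_holomorphic_halfplane:
  fixes f :: "real \<Rightarrow> complex \<Rightarrow> complex"
  assumes w: "\<forall>i<r. w i > 0" and y: "y > 0"
    and hol: "\<And>Y. Y \<ge> y \<Longrightarrow> f Y holomorphic_on {s. Re s > real r - c}"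
    and dom: "\<And>B. \<exists>C\<ge>0. \<forall>Y\<ge>y. \<forall>s. norm s \<le> B \<longrightarrow> norm (f Y s) \<le> C * Y powr (- (Re s + c))"
  shows "(\<lambda>s. \<Sum>\<^sub>\<infinity>m\<in>barnes_idx r. f (y + barnes_lin r w m) s) holomorphic_on {s. Re s > real r - c}"
    and "Re s > real r - c \<Longrightarrow> (\<lambda>m. f (y + barnes_lin r w m) s) summable_on barnes_idx r"
proof -
  show "(\<lambda>s. \<Sum>\<^sub>\<infinity>m\<in>barnes_idx r. f (y + barnes_lin r w m) s) holomorphic_on {s. Re s > real r - c}"
  proof (rule barnes_sum_holomorphic[OF w y open_halfspace_Re_gt hol])
    fix s0 assume "s0 \<in> {s. Re s > real r - c}"
    then have s0: "Re s0 > real r - c" by simp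
    \<comment> \<open>Half the distance to the boundary line: on the disc of radius \<open>d\<close>
      the exponent \<open>Re s + c\<close> lies between \<open>p\<close> and
      \<open>p + 2 * d\<close>, and \<open>p\<close> still exceeds \<open>r\<close>.\<close>
    define d where "d = (Re s0 - (real r - c)) / 2"
    define p where "p = Re s0 - d + c"
    have d: "d > 0" and p: "p > real r" using s0 by (auto simp: d_def p_def field_simps)
    obtain C where C: "C \<ge> 0" "\<And>Y s. Y \<ge> y \<Longrightarrow> norm s \<le> norm s0 + d \<Longrightarrow>
        norm (f Y s) \<le> C * Y powr (- (Re s + c))"
      using dom[of "norm s0 + d"] by blast
    show "\<exists>d>0. \<exists>p>real r. \<exists>B. \<forall>Y\<ge>y. \<forall>s\<in>cball s0 d. norm (f Y s) \<le> B * Y powr (-p)"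
    proof (rule exI[of _ d], intro conjI d, rule exI[of _ p], intro conjI p,
        rule exI[of _ "C * (1 + y powr (- (2 * d)))"], intro allI impI ballI)
      fix Y s assume Y: "Y \<ge> y" and s: "s \<in> cball s0 d"
      have n: "norm s \<le> norm s0 + d"
        using s norm_triangle_sub[of s s0] by (simp add: dist_norm norm_minus_commute)
      have re: "\<bar>Re s - Re s0\<bar> \<le> d"
        using s abs_Re_le_cmod[of "s - s0"] by (simp add: dist_norm norm_minus_commute)
      have "norm (f Y s) \<le> C * Y powr (- (Re s + c))" by (rule C(2)[OF Y n])
      also have "\<dots> \<le> C * ((1 + y powr (- (2 * d))) * Y powr (-p))"
        using re by (intro mult_left_mono powr_shift_le y Y C(1)) (auto simp: p_def)
      finally show "norm (f Y s) \<le> C * (1 + y powr (- (2 * d))) * Y powr (-p)"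
        by (simp add: mult.assoc)
    qed
  qed
  show "(\<lambda>m. f (y + barnes_lin r w m) s) summable_on barnes_idx r" if s: "Re s > real r - c"
  proof -
    obtain C where "C \<ge> 0" "\<And>Y. Y \<ge> y \<Longrightarrow> norm (f Y s) \<le> C * Y powr (- (Re s + c))"
      using dom[of "norm s"] by auto
    then show ?thesis using s by (intro barnes_dominated_summable[OF w y, of "Re s + c"]) auto
  qed
qed

lemma barnes_series_alt:
  "barnes_series r y w s = (\<Sum>\<^sub>\<infinity>m\<in>barnes_idx r. complex_of_real (y + barnes_lin r w m) powr (-s))"
  unfolding barnes_series_def by (simp add: powr_minus divide_inverse)

lemma
  assumes "\<forall>i<r. w i > 0" and "y > 0"
  shows barnes_series_holomorphic: "barnes_series r y w holomorphic_on {s. Re s > real r}"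
    and barnes_series_summable: "Re s > real r \<Longrightarrow>
      (\<lambda>m. complex_of_real (y + barnes_lin r w m) powr (-s)) summable_on barnes_idx r"
proof -
  have dom: "\<exists>C\<ge>0. \<forall>Y\<ge>y. \<forall>s. norm s \<le> B \<longrightarrow>
      norm (complex_of_real Y powr (-s)) \<le> C * Y powr (- (Re s + 0))" for B
    using assms(2) by (intro exI[of _ 1]) (auto simp: norm_of_real_powr)
  have hol: "(\<lambda>s. complex_of_real Y powr (-s)) holomorphic_on {s. Re s > real r - 0}" if "Y \<ge> y" for Y
    using that assms(2) by (auto intro!: holomorphic_intros)
  note * = barnes_sum_holomorphic_halfplane[OF assms hol dom]
  show "barnes_series r y w holomorphic_on {s. Re s > real r}"
    using *(1) unfolding barnes_series_alt by simp
  show "Re s > real r \<Longrightarrow>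
      (\<lambda>m. complex_of_real (y + barnes_lin r w m) powr (-s)) summable_on barnes_idx r"
    using *(2) by simp
qed

text \<open>The remainder after \<open>K\<close> terms of the Taylor expansion of \<open>v \<mapsto> (Y + v)\<^bsup>1 - s\<^esup>\<close> at \<open>v = 0\<close>.\<close>

definition powr_taylor_rem :: "nat \<Rightarrow> real \<Rightarrow> real \<Rightarrow> complex \<Rightarrow> complex" where
  "powr_taylor_rem K v Y s = complex_of_real (Y + v) powr (1 - s)
     - (\<Sum>k<K. (- complex_of_real v) ^ k / fact k * pochhammer (s - 1) k
               * complex_of_real Y powr (- (s - 1 + of_nat k)))"

text \<open>Holds for either sign of \<open>e\<close>, because \<open>z / Y\<close> lies between 1
  and \<open>1 + v / y0\<close>.\<close>

lemma powr_le_ratio: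
  fixes y0 :: real
  assumes "y0 > 0" "Y \<ge> y0" "v \<ge> 0" "Y \<le> z" "z \<le> Y + v" "\<bar>e\<bar> \<le> E"
  shows "z powr e \<le> (1 + v / y0) powr E * Y powr e"
proof -
  have A: "Y + v \<le> (1 + v / y0) * Y"
    using assms mult_right_mono[OF assms(2,3)] by (simp add: field_simps)
  have c1: "1 + v / y0 \<ge> 1" using assms by simp
  have z: "z = (z / Y) * Y" using assms by simp
  have zY: "1 \<le> z / Y" "z / Y \<le> 1 + v / y0"
    using assms A by (auto simp: divide_le_eq)
  have "(z / Y) powr e \<le> (z / Y) powr E" using zY assms(6) by (intro powr_mono) auto
  also have "\<dots> \<le> (1 + v / y0) powr E" using zY assms(6) by (intro powr_mono2) auto
  finally have "(z / Y) powr e * Y powr e \<le> (1 + v / y0) powr E * Y powr e"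
    by (intro mult_right_mono) auto
  then show ?thesis using z by (metis powr_mult)
qed

lemma norm_pochhammer_le:
  fixes z :: complex
  assumes "norm z \<le> B"
  shows "norm (pochhammer z k) \<le> pochhammer B k"
proof (induction k)
  case (Suc k)
  have "norm (z + of_nat k) \<le> B + real k"
    using assms norm_triangle_ineq[of z "of_nat k"] by simp
  then show ?case
    using Suc by (simp add: pochhammer_Suc norm_mult mult_mono')
qed simp

text \<open>Taylor's theorem on the segment from \<open>Y\<close> to \<open>Y + v\<close>: every
  derivative of \<open>x powr (1 - s)\<close> lowers the exponent by one, so the remainder decays
  \<open>K\<close> powers faster than the function itself.\<close>

lemma norm_powr_taylor_rem_le:
  fixes y0 :: real
  assumes v: "v > 0" and y0: "y0 > 0" and K: "K \<ge> 1"
  shows "\<exists>C\<ge>0. \<forall>Y\<ge>y0. \<forall>s. norm s \<le> B \<longrightarrow>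
           norm (powr_taylor_rem K v Y s) \<le> C * Y powr (- (Re s + (real K - 1)))"
proof (cases "B \<ge> 0")
  case True
  obtain n where n: "K = Suc n" using K by (cases K) auto
  \<comment> \<open>Bounds the derivative of order \<open>K\<close> on the segment: the first factor
    uses that \<open>s - 1\<close> has norm at most \<open>B + 1\<close>, the second compares powers
    at a point of the segment with powers at \<open>Y\<close>, the exponent being at most
    \<open>B + K\<close> in absolute value.\<close>
  define C0 where "C0 = pochhammer (B + 1) K * (1 + v / y0) powr (B + K)"
  have C0: "C0 \<ge> 0" using True by (auto simp: C0_def pochhammer_nonneg)
  show ?thesis
  proof (intro exI[of _ "C0 * v ^ K / fact n"] conjI allI impI)
    fix Y :: real and s :: complex assume Y: "Y \<ge> y0" and s: "norm s \<le> B"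
    define S where "S = closed_segment (complex_of_real Y) (complex_of_real (Y + v))"
    \<comment> \<open>\<open>f i\<close> is the \<open>i\<close>-th derivative of
      \<open>x powr (1 - s)\<close>.\<close>
    define f where "f = (\<lambda>i x. (-1) ^ i * pochhammer (s - 1) i * x powr (- (s - 1 + of_nat i)))"
    have S: "\<exists>\<xi>. x = of_real \<xi> \<and> Y \<le> \<xi> \<and> \<xi> \<le> Y + v" if "x \<in> S" for x
      using that v unfolding S_def closed_segment_of_real by (auto simp: closed_segment_eq_real_ivl)
    have der: "(f i has_field_derivative f (Suc i) x) (at x within S)" if "x \<in> S" "i \<le> n" for i x
    proof -
      obtain \<xi> where xi: "x = of_real \<xi>" "Y \<le> \<xi>" using S \<open>x \<in> S\<close> by blast
      have "x \<notin> \<real>\<^sub>\<le>\<^sub>0" using xi Y y0 by (auto simp: complex_nonpos_Reals_iff)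
      from has_field_derivative_powr[OF this, of "- (s - 1 + of_nat i)"]
      have "((\<lambda>x. (-1) ^ i * pochhammer (s - 1) i * x powr (- (s - 1 + of_nat i))) has_field_derivative
         (-1) ^ i * pochhammer (s - 1) i * (- (s - 1 + of_nat i) * x powr (- (s - 1 + of_nat i) - 1))) (at x)"
        by (intro DERIV_cmult)
      also have "(-1) ^ i * pochhammer (s - 1) i * (- (s - 1 + of_nat i) * x powr (- (s - 1 + of_nat i) - 1))
         = f (Suc i) x"
        by (simp add: f_def pochhammer_Suc algebra_simps)
      finally show ?thesis unfolding f_def by (rule has_field_derivative_at_within)
    qed
    have bd: "norm (f (Suc n) x) \<le> C0 * Y powr (- (Re s + (real K - 1)))" if "x \<in> S" for x
    proof -
      obtain \<xi> where xi: "x = of_real \<xi>" "Y \<le> \<xi>" "\<xi> \<le> Y + v" using S \<open>x \<in> S\<close> by blast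
      have re: "\<bar>Re s\<bar> \<le> B" using s abs_Re_le_cmod[of s] by linarith
      have "norm (f (Suc n) x) = norm (pochhammer (s - 1) K) * \<xi> powr (- (Re s + (real K - 1)))"
        using xi Y y0 by (simp add: f_def n norm_mult norm_power norm_of_real_powr)
      also have "\<dots> \<le> pochhammer (B + 1) K * ((1 + v / y0) powr (B + K) * Y powr (- (Re s + (real K - 1))))"
      proof (intro mult_mono)
        show "norm (pochhammer (s - 1) K) \<le> pochhammer (B + 1) K"
          using s norm_triangle_ineq4[of s 1] by (intro norm_pochhammer_le) auto
        show "\<xi> powr (- (Re s + (real K - 1))) \<le> (1 + v / y0) powr (B + K) * Y powr (- (Re s + (real K - 1)))"
          using xi Y y0 v re True K by (intro powr_le_ratio) auto
      qed (use True in \<open>auto simp: pochhammer_nonneg\<close>)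
      finally show ?thesis by (simp add: C0_def mult.assoc)
    qed
    have "norm (f 0 (of_real (Y + v)) - (\<Sum>i\<le>n. f i (of_real Y) * (of_real (Y + v) - of_real Y) ^ i / fact i))
       \<le> C0 * Y powr (- (Re s + (real K - 1))) * norm (complex_of_real (Y + v) - of_real Y) ^ Suc n / fact n"
      by (rule complex_Taylor[OF _ der bd]) (auto simp: S_def)
    also have "f 0 (of_real (Y + v)) - (\<Sum>i\<le>n. f i (of_real Y) * (of_real (Y + v) - of_real Y) ^ i / fact i)
       = powr_taylor_rem K v Y s"
    proof -
      have "f i (of_real Y) * (of_real (Y + v) - of_real Y) ^ i / fact i =
          (- complex_of_real v) ^ i / fact i * pochhammer (s - 1) i
               * complex_of_real Y powr (- (s - 1 + of_nat i))" for i
        by (simp add: f_def power_minus[of "complex_of_real v"])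
      then have "(\<Sum>i\<le>n. f i (of_real Y) * (of_real (Y + v) - of_real Y) ^ i / fact i) =
          (\<Sum>i<K. (- complex_of_real v) ^ i / fact i * pochhammer (s - 1) i
               * complex_of_real Y powr (- (s - 1 + of_nat i)))"
        unfolding n lessThan_Suc_atMost by (intro sum.cong) auto
      then show ?thesis by (simp add: powr_taylor_rem_def f_def)
    qed
    also have "norm (complex_of_real (Y + v) - of_real Y) = v" using v by simp
    finally show "norm (powr_taylor_rem K v Y s) \<le> C0 * v ^ K / fact n * Y powr (- (Re s + (real K - 1)))"
      by (simp add: n algebra_simps)
  qed (use C0 v in simp)
next
  case False
  have "\<not> norm s \<le> B" for s :: complex using False norm_ge_zero[of s] by linarith
  then show ?thesis by (intro exI[of _ 0]) auto
qed

text \<open>Each further Taylor term moves the boundary of the half-plane of convergence one unit to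
  the left. This is the source of the continuation.\<close>

lemma
  assumes "\<forall>i<r. w i > 0" and "y > 0" and "v > 0" and "K \<ge> 1"
  shows powr_taylor_rem_sum_holomorphic:
      "(\<lambda>s. \<Sum>\<^sub>\<infinity>m\<in>barnes_idx r. powr_taylor_rem K v (y + barnes_lin r w m) s)
         holomorphic_on {s. Re s > real r - (real K - 1)}"
    and powr_taylor_rem_summable: "Re s > real r - (real K - 1) \<Longrightarrow>
      (\<lambda>m. powr_taylor_rem K v (y + barnes_lin r w m) s) summable_on barnes_idx r"
proof -
  have hol: "powr_taylor_rem K v Y holomorphic_on {s. Re s > real r - (real K - 1)}" if "Y \<ge> y" for Y
    using that assms unfolding powr_taylor_rem_def[abs_def] by (auto intro!: holomorphic_intros)
  note * = barnes_sum_holomorphic_halfplane[OF assms(1,2) hol norm_powr_taylor_rem_le[OF assms(3,2,4)]]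
  show "(\<lambda>s. \<Sum>\<^sub>\<infinity>m\<in>barnes_idx r. powr_taylor_rem K v (y + barnes_lin r w m) s)
         holomorphic_on {s. Re s > real r - (real K - 1)}"
    using *(1) by simp
  show "Re s > real r - (real K - 1) \<Longrightarrow>
      (\<lambda>m. powr_taylor_rem K v (y + barnes_lin r w m) s) summable_on barnes_idx r"
    using *(2) by simp
qed

section \<open>Shift relation and recursion for the series\<close>

lemma has_sum_diff:
  fixes f g :: "'a \<Rightarrow> 'b::{topological_ab_group_add}"
  assumes "(f has_sum a) A" "(g has_sum b) A"
  shows "((\<lambda>x. f x - g x) has_sum (a - b)) A"
  using has_sum_add[OF assms(1), of "\<lambda>x. - g x" "- b"] assms(2) by (simp add: has_sum_uminus)

lemma has_sum_finite_sum:
  fixes f :: "'i \<Rightarrow> 'a \<Rightarrow> 'b::{topological_comm_monoid_add}"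
  assumes "finite I" "\<And>i. i \<in> I \<Longrightarrow> (f i has_sum S i) A"
  shows "((\<lambda>x. \<Sum>i\<in>I. f i x) has_sum (\<Sum>i\<in>I. S i)) A"
  using assms by (induction I) (auto intro!: has_sum_add)

lemma infsum_nat_split_head:
  fixes f :: "nat \<Rightarrow> complex"
  assumes "f summable_on UNIV"
  shows "infsum f UNIV = f 0 + (\<Sum>\<^sub>\<infinity>n. f (Suc n))"
proof -
  have "(\<lambda>n. f (Suc n)) summable_on UNIV"
    using summable_on_subset[OF assms, of "range Suc"] by (simp add: summable_on_reindex o_def)
  then have s: "(\<lambda>n. f (Suc n)) sums (\<Sum>\<^sub>\<infinity>n. f (Suc n))"
    by (simp add: has_sum_imp_sums)
  have "f sums infsum f UNIV" using assms by (simp add: has_sum_imp_sums)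
  moreover have "f sums ((\<Sum>\<^sub>\<infinity>n. f (Suc n)) + f 0)" by (rule sums_Suc[OF s])
  ultimately show ?thesis using sums_unique2 by (metis add.commute)
qed

text \<open>Moving the base point by \<open>w r\<close> drops exactly the index vectors whose last
  entry is 0, and these make up the series of rank \<open>r\<close>.\<close>

lemma barnes_series_shift:
  assumes w: "\<forall>i<Suc r. w i > 0" and y: "y > 0" and s: "Re s > real (Suc r)"
  shows "barnes_series (Suc r) y w s - barnes_series (Suc r) (y + w r) w s = barnes_series r y w s"
proof -
  define f where "f = (\<lambda>Y. complex_of_real Y powr (-s))"
  have v: "y + w r > 0" using w y by (simp add: add_pos_pos)
  note A = barnes_sum_Suc[of f y r w] and B = barnes_sum_Suc[of f "y + w r" r w]
  have sA: "(\<lambda>m. f (y + barnes_lin (Suc r) w m)) summable_on barnes_idx (Suc r)"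
    unfolding f_def by (rule barnes_series_summable[OF w y s])
  have sB: "(\<lambda>m. f (y + w r + barnes_lin (Suc r) w m)) summable_on barnes_idx (Suc r)"
    unfolding f_def by (rule barnes_series_summable[OF w v s])
  have sC: "(\<lambda>m. f (y + barnes_lin r w m)) summable_on barnes_idx r"
    unfolding f_def using w y s by (intro barnes_series_summable) auto
  have "barnes_series (Suc r) y w s =
    (\<Sum>\<^sub>\<infinity>m\<in>barnes_idx r. \<Sum>\<^sub>\<infinity>n. f (y + barnes_lin r w m + real n * w r))"
    using A(1)[OF sA] by (simp add: barnes_series_alt f_def)
  also have "\<dots> = (\<Sum>\<^sub>\<infinity>m\<in>barnes_idx r. f (y + barnes_lin r w m)
      + (\<Sum>\<^sub>\<infinity>n. f (y + w r + barnes_lin r w m + real n * w r)))"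
    by (rule infsum_cong, subst infsum_nat_split_head[OF A(3)[OF sA]]) (auto simp: algebra_simps)
  also have "\<dots> = barnes_series r y w s + barnes_series (Suc r) (y + w r) w s"
    using B(1)[OF sB] infsum_add[OF sC B(2)[OF sB]] by (simp add: barnes_series_alt f_def)
  finally show ?thesis by simp
qed

text \<open>The sum of the shifted powers and the term \<open>k = 0\<close> combine, by the shift
  relation, into a series of rank \<open>r\<close> at \<open>s - 1\<close>. The term
  \<open>k = 1\<close> carries the value at \<open>s\<close>. The bound on \<open>Re s\<close> puts
  even \<open>s - 1\<close> into the half-plane of convergence.\<close>

lemma powr_taylor_rem_sum:
  assumes w: "\<forall>i<Suc r. w i > 0" and y: "y > 0" and s: "Re s > real r + 2" and K: "K \<ge> 1"
  shows "(\<Sum>\<^sub>\<infinity>m\<in>barnes_idx (Suc r). powr_taylor_rem K (w r) (y + barnes_lin (Suc r) w m) s)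
    = - barnes_series r y w (s - 1)
      - (\<Sum>k=1..<K. (- complex_of_real (w r)) ^ k / fact k * pochhammer (s - 1) k
           * barnes_series (Suc r) y w (s - 1 + of_nat k))"
proof -
  define c where "c = (\<lambda>k. (- complex_of_real (w r)) ^ k / fact k * pochhammer (s - 1) k)"
  define Z where "Z = (\<lambda>k. barnes_series (Suc r) y w (s - 1 + of_nat k))"
  have v: "y + w r > 0" using w y by (simp add: add_pos_pos)
  have hs: "((\<lambda>m. complex_of_real (y' + barnes_lin (Suc r) w m) powr (- s')) has_sum
      barnes_series (Suc r) y' w s') (barnes_idx (Suc r))" if "y' > 0" "Re s' > real (Suc r)" for y' s'
    using barnes_series_summable[OF w that] by (simp add: barnes_series_alt)
  have "((\<lambda>m. powr_taylor_rem K (w r) (y + barnes_lin (Suc r) w m) s) has_sum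
    (barnes_series (Suc r) (y + w r) w (s - 1) - (\<Sum>k<K. c k * Z k))) (barnes_idx (Suc r))"
    unfolding powr_taylor_rem_def
  proof (intro has_sum_diff has_sum_finite_sum)
    show "((\<lambda>m. complex_of_real (y + barnes_lin (Suc r) w m + w r) powr (1 - s)) has_sum
       barnes_series (Suc r) (y + w r) w (s - 1)) (barnes_idx (Suc r))"
      using hs[OF v, of "s - 1"] s by (simp add: algebra_simps)
    show "((\<lambda>m. (- complex_of_real (w r)) ^ k / fact k * pochhammer (s - 1) k *
        complex_of_real (y + barnes_lin (Suc r) w m) powr (- (s - 1 + of_nat k))) has_sum c k * Z k)
       (barnes_idx (Suc r))" for k
      unfolding c_def Z_def using s by (intro has_sum_cmult_right hs y) auto
  qed simp
  then have "(\<Sum>\<^sub>\<infinity>m\<in>barnes_idx (Suc r). powr_taylor_rem K (w r) (y + barnes_lin (Suc r) w m) s)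
      = barnes_series (Suc r) (y + w r) w (s - 1) - (\<Sum>k<K. c k * Z k)"
    by (rule infsumI)
  also have "(\<Sum>k<K. c k * Z k) = c 0 * Z 0 + (\<Sum>k=1..<K. c k * Z k)"
    using K by (simp add: lessThan_atLeast0 sum.atLeast_Suc_lessThan)
  also have "c 0 * Z 0 = barnes_series r y w (s - 1) + barnes_series (Suc r) (y + w r) w (s - 1)"
    using barnes_series_shift[OF w y, of "s - 1"] s by (simp add: c_def Z_def algebra_simps)
  finally show ?thesis by (simp add: c_def Z_def)
qed

text \<open>Multiplication by \<open>(s - 1) \<cdots> (s - r)\<close> removes the poles.\<close>

definition barnes_entire_part :: "nat \<Rightarrow> real \<Rightarrow> (nat \<Rightarrow> real) \<Rightarrow> complex \<Rightarrow> complex" where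
  "barnes_entire_part r y w s = pochhammer (s - of_nat r) r * barnes_series r y w s"

lemma barnes_entire_part_holomorphic:
  "\<forall>i<r. w i > 0 \<Longrightarrow> y > 0 \<Longrightarrow> barnes_entire_part r y w holomorphic_on {s. Re s > real r}"
  unfolding barnes_entire_part_def[abs_def]
  by (intro holomorphic_intros barnes_series_holomorphic)

text \<open>The summed Taylor expansion is multiplied by
  \<open>pochhammer (s - of_nat (Suc r)) r\<close>, that is by (s - r - 1) ... (s - 2), which
  completes each \<open>pochhammer (s - 1) k\<close> to contain the pole factors at
  \<open>s - 1 + of_nat k\<close>. The term \<open>k = 1\<close> becomes the left-hand side up to
  sign; those with \<open>k\<close> at least 2 only involve points further to the right.\<close>

lemma barnes_entire_part_rec:
  assumes w: "\<forall>i<Suc r. w i > 0" and y: "y > 0" and s: "Re s > real r + 2" and K: "K \<ge> 2"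
  shows "complex_of_real (w r) * barnes_entire_part (Suc r) y w s =
    barnes_entire_part r y w (s - 1)
    + (\<Sum>k=2..<K. (- complex_of_real (w r)) ^ k / fact k * pochhammer (s - of_nat (Suc r)) (k - 1)
           * barnes_entire_part (Suc r) y w (s - 1 + of_nat k))
    + pochhammer (s - of_nat (Suc r)) r
      * (\<Sum>\<^sub>\<infinity>m\<in>barnes_idx (Suc r). powr_taylor_rem K (w r) (y + barnes_lin (Suc r) w m) s)"
proof -
  define P where "P = pochhammer (s - of_nat (Suc r)) r"
  define d where "d = (\<lambda>k. (- complex_of_real (w r)) ^ k / fact k * pochhammer (s - of_nat (Suc r)) (k - 1)
           * barnes_entire_part (Suc r) y w (s - 1 + of_nat k))"
  have trm: "P * ((- complex_of_real (w r)) ^ k / fact k * pochhammer (s - 1) k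
           * barnes_series (Suc r) y w (s - 1 + of_nat k)) = d k" if k: "k \<ge> 1" for k
  proof -
    have "P * pochhammer (s - 1) k = pochhammer (s - of_nat (Suc r)) (r + k)"
      unfolding P_def pochhammer_product' by simp
    \<comment> \<open>Regrouped so that the last \<open>r + 1\<close> factors are the pole factors
      at the point \<open>s - 1 + of_nat k\<close>.\<close>
    also have "r + k = (k - 1) + Suc r" using k by simp
    also have "pochhammer (s - of_nat (Suc r)) ((k - 1) + Suc r) =
      pochhammer (s - of_nat (Suc r)) (k - 1) * pochhammer (s - 1 + of_nat k - of_nat (Suc r)) (Suc r)"
      unfolding pochhammer_product' using k by (simp add: of_nat_diff algebra_simps)
    finally have "P * pochhammer (s - 1) k = pochhammer (s - of_nat (Suc r)) (k - 1)
       * pochhammer (s - 1 + of_nat k - of_nat (Suc r)) (Suc r)" .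
    note eq = this
    have "P * (c * q * z) = c * (P * q) * z" for c q z :: complex by (simp add: mult_ac)
    then show ?thesis unfolding d_def barnes_entire_part_def by (simp only: eq) (simp only: mult.assoc)
  qed
  have "P * (\<Sum>\<^sub>\<infinity>m\<in>barnes_idx (Suc r). powr_taylor_rem K (w r) (y + barnes_lin (Suc r) w m) s)
    = - (P * barnes_series r y w (s - 1)) - (\<Sum>k=1..<K. d k)"
    unfolding powr_taylor_rem_sum[OF w y s order_trans[OF one_le_numeral K]]
    using trm by (simp add: right_diff_distrib sum_distrib_left)
  also have "P * barnes_series r y w (s - 1) = barnes_entire_part r y w (s - 1)"
    by (simp add: P_def barnes_entire_part_def algebra_simps)
  also have "(\<Sum>k=1..<K. d k) = d 1 + (\<Sum>k=2..<K. d k)"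
    using K by (simp add: sum.atLeast_Suc_lessThan numeral_2_eq_2)
  also have "d 1 = - (complex_of_real (w r) * barnes_entire_part (Suc r) y w s)"
    by (simp add: d_def)
  finally show ?thesis by (simp add: P_def d_def)
qed

text \<open>The recursion serves as a definition one unit further to the left: it calls
  \<open>f\<close> only at points at least one unit to the right, and \<open>W\<close> supplies the
  part of lower rank. It reproduces the series for \<open>Re s > real r + 2\<close>, hence on the
  whole half-plane of convergence by the identity theorem.\<close>

lemma barnes_entire_part_strip:
  assumes w: "\<forall>i<Suc r. w i > 0" and y: "y > 0"
    and W: "W holomorphic_on UNIV" "\<And>s. Re s > real r \<Longrightarrow> W s = barnes_entire_part r y w s"
  shows "\<exists>f. f holomorphic_on {s. Re s > real (Suc r) - real n} \<and>
    (\<forall>s. Re s > real (Suc r) \<longrightarrow> f s = barnes_entire_part (Suc r) y w s)"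
proof (induction n)
  case 0
  show ?case using barnes_entire_part_holomorphic[OF w y] by auto
next
  case (Suc n)
  then obtain f where f: "f holomorphic_on {s. Re s > real (Suc r) - real n}"
    "\<And>s. Re s > real (Suc r) \<Longrightarrow> f s = barnes_entire_part (Suc r) y w s" by blast
  \<comment> \<open>With \<open>n + 2\<close> Taylor terms the remainder sum converges for
    \<open>Re s > real r - real n\<close>, exactly the next half-plane.\<close>
  define K where "K = Suc (Suc n)"
  define U where "U = {s. Re s > real (Suc r) - real (Suc n)}"
  define g where "g = (\<lambda>s. (W (s - 1)
    + (\<Sum>k=2..<K. (- complex_of_real (w r)) ^ k / fact k * pochhammer (s - of_nat (Suc r)) (k - 1)
           * f (s - 1 + of_nat k))
    + pochhammer (s - of_nat (Suc r)) r
      * (\<Sum>\<^sub>\<infinity>m\<in>barnes_idx (Suc r). powr_taylor_rem K (w r) (y + barnes_lin (Suc r) w m) s)) / w r)"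
  have v: "w r > 0" using w by simp
  have fk: "(\<lambda>s. f (s - 1 + of_nat k)) holomorphic_on U" if "k \<ge> 2" for k
    by (rule holomorphic_on_compose_gen[OF _ f(1), of "\<lambda>s. s - 1 + of_nat k" U, unfolded o_def])
       (use that in \<open>auto simp: U_def intro!: holomorphic_intros\<close>)
  have W1: "(\<lambda>s. W (s - 1)) holomorphic_on U"
    by (rule holomorphic_on_compose_gen[OF _ W(1), of "\<lambda>s. s - 1" U, unfolded o_def])
       (auto intro!: holomorphic_intros)
  have R: "(\<lambda>s. \<Sum>\<^sub>\<infinity>m\<in>barnes_idx (Suc r). powr_taylor_rem K (w r) (y + barnes_lin (Suc r) w m) s)
     holomorphic_on U"
    using powr_taylor_rem_sum_holomorphic[OF w y v, of K] by (simp add: U_def K_def)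
  have g: "g holomorphic_on U"
    unfolding g_def using v by (intro holomorphic_intros W1 fk R) auto
  have eq: "g s = barnes_entire_part (Suc r) y w s" if "Re s > real r + 2" for s
  proof -
    have "(\<Sum>k=2..<K. (- complex_of_real (w r)) ^ k / fact k * pochhammer (s - of_nat (Suc r)) (k - 1)
           * f (s - 1 + of_nat k)) = (\<Sum>k=2..<K. (- complex_of_real (w r)) ^ k / fact k
           * pochhammer (s - of_nat (Suc r)) (k - 1) * barnes_entire_part (Suc r) y w (s - 1 + of_nat k))"
      using that by (intro sum.cong) (auto simp: f(2))
    then have "g s = (w r * barnes_entire_part (Suc r) y w s) / w r"
      unfolding g_def using that
      by (subst barnes_entire_part_rec[OF w y that, of K]) (auto simp: W(2) K_def)
    then show ?thesis using v by simp
  qed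
  have "g s = barnes_entire_part (Suc r) y w s" if "Re s > real (Suc r)" for s
  proof (rule analytic_continuation_open[of "{s. Re s > real r + 2}" "{s. Re s > real (Suc r)}" g _ s])
    show "{s. Re s > real r + 2} \<noteq> {}" by (auto intro!: exI[of _ "of_real (real r + 3)"])
    show "g holomorphic_on {s. Re s > real (Suc r)}"
      by (rule holomorphic_on_subset[OF g]) (auto simp: U_def)
    show "barnes_entire_part (Suc r) y w holomorphic_on {s. Re s > real (Suc r)}"
      by (rule barnes_entire_part_holomorphic[OF w y])
  qed (use that eq in \<open>auto intro!: open_halfspace_Re_gt\<close>)
  then show ?case using g unfolding U_def by blast
qed

text \<open>Induction on the rank, starting from the plain power in rank 0. The extensions to larger
  and larger half-planes agree where they overlap, by the identity theorem, and are glued.\<close>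

lemma barnes_entire_part_extension:
  assumes w: "\<forall>i<r. w i > 0" and y: "y > 0"
  shows "\<exists>W. W holomorphic_on UNIV \<and> (\<forall>s. Re s > real r \<longrightarrow> W s = barnes_entire_part r y w s)"
  using w
proof (induction r)
  case 0
  have "(\<lambda>s. complex_of_real y powr (-s)) holomorphic_on UNIV"
    using y by (auto intro!: holomorphic_intros)
  then show ?case
    by (intro exI[of _ "\<lambda>s. complex_of_real y powr (-s)"])
       (auto simp: barnes_entire_part_def barnes_series_alt barnes_idx_0 barnes_lin_def)
next
  case (Suc r)
  then obtain W0 where "W0 holomorphic_on UNIV" "\<And>s. Re s > real r \<Longrightarrow> W0 s = barnes_entire_part r y w s"
    by fastforce
  from barnes_entire_part_strip[OF Suc.prems y this]
  obtain F where F: "\<And>n. F n holomorphic_on {s. Re s > real (Suc r) - real n}"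
    "\<And>n s. Re s > real (Suc r) \<Longrightarrow> F n s = barnes_entire_part (Suc r) y w s" by metis
  have agree: "F n s = F m s" if "n \<le> m" "Re s > real (Suc r) - real n" for n m s
  proof (rule analytic_continuation_open[of "{s. Re s > real (Suc r)}" "{s. Re s > real (Suc r) - real n}"
        "F n" "F m" s])
    show "{s. Re s > real (Suc r)} \<noteq> {}" by (auto intro!: exI[of _ "of_real (real r + 3)"])
    show "F m holomorphic_on {s. Re s > real (Suc r) - real n}"
      by (rule holomorphic_on_subset[OF F(1)]) (use that in auto)
  qed (use that F in \<open>auto intro!: open_halfspace_Re_gt\<close>)
  \<comment> \<open>An index large enough for \<open>s\<close> to lie in the half-plane of
    \<open>F (N s)\<close>.\<close>
  define N where "N = (\<lambda>s. nat \<lceil>real (Suc r) - Re s\<rceil> + 1)"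
  have N: "Re s > real (Suc r) - real (N s)" for s unfolding N_def by linarith
  define W where "W = (\<lambda>s. F (N s) s)"
  have WF: "W s = F n s" if "Re s > real (Suc r) - real n" for n s
    unfolding W_def using agree[of n "N s", OF _ that] agree[of "N s" n, OF _ N]
    by (metis nat_le_linear)
  have "W holomorphic_on UNIV"
    unfolding holomorphic_on_def
  proof
    fix s :: complex
    have "W holomorphic_on {z. Re z > real (Suc r) - real (N s)}"
      by (rule holomorphic_transform[OF F(1)[of "N s"]]) (simp add: WF[symmetric])
    then show "W field_differentiable at s within UNIV"
      by (rule holomorphic_on_imp_differentiable_at)
         (use N in \<open>auto intro!: open_halfspace_Re_gt\<close>)
  qed
  moreover have "W s = barnes_entire_part (Suc r) y w s" if "Re s > real (Suc r)" for s
    using WF[of 0 s] F(2)[OF that] that by simp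
  ultimately show ?case by blast
qed

section \<open>Existence and uniqueness of the continuation\<close>

lemma finite_barnes_poles: "finite (barnes_poles r)"
proof -
  have "barnes_poles r = of_nat ` {1..r}" by (auto simp: barnes_poles_def)
  then show ?thesis by simp
qed

lemma pochhammer_eq_prod_poles:
  "pochhammer (s - of_nat r) r = (\<Prod>k=1..r. (s - of_nat k :: complex))"
proof -
  have "pochhammer (s - of_nat r) r = (\<Prod>i<r. s - of_nat r + of_nat i)"
    by (simp add: pochhammer_prod lessThan_atLeast0)
  also have "\<dots> = (\<Prod>k=1..r. (s - of_nat k))"
    by (rule prod.reindex_bij_witness[of _ "\<lambda>k. r - k" "\<lambda>i. r - i"]) (auto simp: of_nat_diff)
  finally show ?thesis .
qed

lemma prod_poles_eq_0_iff: "(\<Prod>k=1..r. (s - of_nat k :: complex)) = 0 \<longleftrightarrow> s \<in> barnes_poles r"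
  by (auto simp: barnes_poles_def)

lemma Re_barnes_poles_le: "s \<in> barnes_poles r \<Longrightarrow> Re s \<le> real r"
  by (auto simp: barnes_poles_def)

text \<open>Justifies the description operator in \<open>barnes_zeta\<close>. Existence: the entire
  extension divided by the pole factors. Uniqueness: removing finitely many points leaves the plane
  connected, so the identity theorem applies off the poles.\<close>

lemma
  assumes w: "\<forall>i<r. w i > 0" and y: "y > 0"
  shows barnes_zeta_holomorphic: "barnes_zeta r y w holomorphic_on (- barnes_poles r)"
    and barnes_zeta_eq_series: "Re s > real r \<Longrightarrow> barnes_zeta r y w s = barnes_series r y w s"
proof -
  define P where "P = (\<lambda>f. f holomorphic_on (- barnes_poles r)
      \<and> (\<forall>s. Re s > real r \<longrightarrow> f s = barnes_series r y w s)
      \<and> (\<forall>s\<in>barnes_poles r. f s = 0))"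
  obtain W where W: "W holomorphic_on UNIV" "\<And>s. Re s > real r \<Longrightarrow> W s = barnes_entire_part r y w s"
    using barnes_entire_part_extension[OF w y] by blast
  have "P (\<lambda>s. W s / (\<Prod>k=1..r. (s - of_nat k)))"
    unfolding P_def
  proof (intro conjI allI impI ballI)
    show "(\<lambda>s. W s / (\<Prod>k=1..r. (s - of_nat k))) holomorphic_on (- barnes_poles r)"
      by (intro holomorphic_intros holomorphic_on_subset[OF W(1)])
         (use prod_poles_eq_0_iff in blast)+
    show "W s / (\<Prod>k=1..r. (s - of_nat k)) = barnes_series r y w s" if "Re s > real r" for s
    proof -
      have "(\<Prod>k=1..r. (s - of_nat k)) \<noteq> 0"
        unfolding prod_poles_eq_0_iff using Re_barnes_poles_le that by fastforce
      then show ?thesis using W(2)[OF that]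
        by (simp only: barnes_entire_part_def pochhammer_eq_prod_poles) simp
    qed
    \<comment> \<open>The denominator vanishes here, and division by zero yields 0, which is the
      value prescribed at the poles.\<close>
    show "W s / (\<Prod>k=1..r. (s - of_nat k)) = 0" if "s \<in> barnes_poles r" for s
      using that by (simp only: prod_poles_eq_0_iff[symmetric]) simp
  qed
  moreover have "f = g" if f: "P f" and g: "P g" for f g
  proof
    fix s
    show "f s = g s"
    proof (cases "s \<in> barnes_poles r")
      case False
      show ?thesis
      proof (rule analytic_continuation_open[of "{s. Re s > real r}" "- barnes_poles r" f g s])
        show "{s. Re s > real r} \<noteq> {}" by (auto intro!: exI[of _ "of_real (real r + 3)"])
        show "open (- barnes_poles r)" using finite_barnes_poles by (simp add: finite_imp_closed open_Compl)
        show "connected (- barnes_poles r)"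
          using connected_open_delete_finite[of UNIV "barnes_poles r"] finite_barnes_poles
          by (simp add: Compl_eq_Diff_UNIV connected_UNIV)
        show "{s. Re s > real r} \<subseteq> - barnes_poles r" by (auto dest: Re_barnes_poles_le)
      qed (use f g False in \<open>auto simp: P_def open_halfspace_Re_gt\<close>)
    qed (use f g in \<open>auto simp: P_def\<close>)
  qed
  ultimately have "P (THE f. P f)" by (auto intro!: theI[of P])
  then have "P (barnes_zeta r y w)" unfolding P_def barnes_zeta_def .
  then show "barnes_zeta r y w holomorphic_on (- barnes_poles r)"
    "Re s > real r \<Longrightarrow> barnes_zeta r y w s = barnes_series r y w s"
    unfolding P_def by auto
qed

section \<open>One-dimensional sums with a non-resonant phase\<close>

lemma exp_neq_1_ball:
  fixes z :: complex
  assumes "norm z < 2 * pi" "z \<noteq> 0"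
  shows "exp z \<noteq> 1"
proof
  assume "exp z = 1"
  then obtain n :: int where n: "Re z = 0" "Im z = of_int (2 * n) * pi"
    unfolding exp_eq_1 by blast
  then have "norm z = \<bar>real_of_int n\<bar> * (2 * pi)"
    by (simp add: cmod_eq_Im abs_mult)
  with assms have "\<bar>real_of_int n\<bar> * (2 * pi) < 1 * (2 * pi)" by simp
  then have "\<bar>real_of_int n\<bar> < 1" by (subst (asm) mult_less_cancel_right) auto
  then have "n = 0" by linarith
  then show False using n assms by (simp add: complex_eq_iff)
qed

text \<open>For \<open>0 < |z| < 2 \<pi>\<close> the solution is \<open>Q z = 1 / (1 - exp z) + 1 / z\<close>, which has a removable
  singularity at \<open>0\<close>; the next pole is at \<open>\<plusminus> 2 \<pi> \<i>\<close>.\<close>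

lemma ex_exp_difference_kernel:
  assumes c: "c < 2 * pi"
  shows "\<exists>Q B. B \<ge> 0 \<and> (\<forall>z. norm z \<le> c \<longrightarrow> norm (Q z) \<le> B) \<and>
     (\<forall>z z'. norm z \<le> c \<longrightarrow> norm z' \<le> c \<longrightarrow> norm (Q z - Q z') \<le> B * norm (z - z')) \<and>
     (\<forall>z. norm z \<le> c \<longrightarrow> z \<noteq> 0 \<longrightarrow> 1 - (exp z - 1) / z = Q z * (1 - exp z :: complex))"
proof -
  \<comment> \<open>\<open>h\<close> is \<open>(exp z - 1) / z\<close> with its removable
    singularity filled in. It has no zero in the disc, so its reciprocal \<open>k\<close> is
    holomorphic there.\<close>
  define h where "h = (\<lambda>z::complex. if z = 0 then deriv exp 0 else (exp z - exp 0) / (z - 0))"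
  define U where "U = ball (0::complex) (2 * pi)"
  have h: "h holomorphic_on U"
    unfolding h_def U_def by (rule pole_lemma_open) (auto intro!: holomorphic_intros)
  have h0: "h 0 = 1" by (simp add: h_def DERIV_imp_deriv[OF DERIV_exp])
  have hz: "h z = (exp z - 1) / z" if "z \<noteq> 0" for z using that by (simp add: h_def)
  have hnz: "h z \<noteq> 0" if "z \<in> U" for z
    using that exp_neq_1_ball[of z] h0 hz[of z] by (cases "z = 0") (auto simp: U_def)
  define k where "k = (\<lambda>z. 1 / h z)"
  have k: "k holomorphic_on U" unfolding k_def using h hnz by (intro holomorphic_intros) auto
  \<comment> \<open>Minus the difference quotient of \<open>k\<close> at 0. Since
    \<open>k 0 = 1\<close>, it is the stated kernel away from 0.\<close>
  define Q where "Q = (\<lambda>z. - (if z = 0 then deriv k 0 else (k z - k 0) / (z - 0)))"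
  have Q: "Q holomorphic_on U"
    unfolding Q_def by (intro holomorphic_intros pole_lemma_open[OF k]) (simp add: U_def)
  have id: "1 - (exp z - 1) / z = Q z * (1 - exp z)" if "z \<in> U" "z \<noteq> 0" for z
  proof -
    have e: "exp z - 1 \<noteq> 0" using that exp_neq_1_ball[of z] by (auto simp: U_def)
    have "Q z = - ((z / (exp z - 1) - 1) / z)"
      using that by (simp add: Q_def k_def h0 hz)
    then show ?thesis using e that(2) by (simp add: field_simps)
  qed
  have sub: "cball 0 c \<subseteq> U" using c by (auto simp: U_def)
  have "compact (Q ` cball 0 c)"
    by (rule compact_continuous_image[OF holomorphic_on_imp_continuous_on[OF holomorphic_on_subset[OF Q sub]]
          compact_cball])
  then have "bounded (Q ` cball 0 c)" by (rule compact_imp_bounded)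
  then obtain B1 where B1: "\<And>z. z \<in> cball 0 c \<Longrightarrow> norm (Q z) \<le> B1"
    unfolding bounded_iff by (metis imageI)
  have dQ: "deriv Q holomorphic_on U" by (rule holomorphic_deriv[OF Q]) (simp add: U_def)
  have "compact (deriv Q ` cball 0 c)"
    by (rule compact_continuous_image[OF holomorphic_on_imp_continuous_on[OF holomorphic_on_subset[OF dQ sub]]
          compact_cball])
  then have "bounded (deriv Q ` cball 0 c)" by (rule compact_imp_bounded)
  then obtain B2 where B2: "\<And>z. z \<in> cball 0 c \<Longrightarrow> norm (deriv Q z) \<le> B2"
    unfolding bounded_iff by (metis imageI)
  define B where "B = max 0 (max B1 B2)"
  have lip: "norm (Q z - Q z') \<le> B * norm (z - z')" if "z \<in> cball 0 c" "z' \<in> cball 0 c" for z z'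
  proof (rule field_differentiable_bound[OF convex_cball _ _ that])
    fix x :: complex assume x: "x \<in> cball 0 c"
    show "(Q has_field_derivative deriv Q x) (at x within cball 0 c)"
      using x sub by (intro has_field_derivative_at_within[OF holomorphic_derivI[OF Q]])
        (auto simp: U_def)
    show "norm (deriv Q x) \<le> B" using B2[OF x] by (simp add: B_def)
  qed
  have "norm (Q z) \<le> B" if "z \<in> cball 0 c" for z using B1[OF that] by (simp add: B_def)
  then show ?thesis
    using lip id sub by (intro exI[of _ Q] exI[of _ B]) (auto simp: B_def)
qed

lemma norm_exp_minus_1_le:
  fixes z :: complex
  shows "norm (exp z - 1) \<le> norm z * exp (norm z)"
proof -
  have "norm (exp z - exp 0) \<le> exp (norm z) * norm (z - 0)"
  proof (rule field_differentiable_bound[of "cball 0 (norm z)" exp exp])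
    fix x :: complex assume "x \<in> cball 0 (norm z)"
    then show "norm (exp x) \<le> exp (norm z)"
      using complex_Re_le_cmod[of x] by (simp add: norm_exp_eq_Re)
  qed (auto intro: DERIV_exp has_field_derivative_at_within)
  then show ?thesis by (simp add: mult.commute)
qed

text \<open>Within one step the power merely rotates, up to a relative error of order
  \<open>v / y\<close>. With \<open>\<delta> = v / y\<close>, replacing
  \<open>ln (1 + u * \<delta>)\<close> by \<open>u * \<delta>\<close> costs at most
  \<open>\<delta> * \<delta>\<close>, which even multiplied by \<open>Im s\<close> stays below
  \<open>2 * pi * \<delta>\<close>; the real part of \<open>s\<close> contributes at most
  \<open>S * \<delta>\<close>.\<close>

lemma powr_shift_eq_phase:
  fixes S :: real
  assumes y: "y > 0" and v: "v > 0" and \<sigma>: "\<bar>Re s\<bar> \<le> S" and t: "\<bar>Im s\<bar> * v / y \<le> 2 * pi"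
    and u: "0 \<le> u" "u \<le> 1"
  shows "norm (complex_of_real (y + u * v) powr (-s)
            - complex_of_real y powr (-s) * exp (- (\<i> * of_real (Im s * v / y)) * of_real u))
         \<le> (S + 2 * pi) * exp ((S + 2 * pi) * (v / y)) * (v / y) * y powr (- Re s)"
proof -
  define \<delta> where "\<delta> = v / y"
  define L where "L = ln (1 + u * \<delta>)"
  \<comment> \<open>The error in the exponent: \<open>- s * L\<close> is the pure phase
    \<open>z\<close> plus \<open>\<eta>\<close>.\<close>
  define \<eta> where "\<eta> = - complex_of_real (Re s * L) - \<i> * complex_of_real (Im s * (L - u * \<delta>))"
  define z where "z = - (\<i> * complex_of_real (Im s * v / y)) * complex_of_real u"
  have \<delta>: "\<delta> > 0" using y v by (simp add: \<delta>_def)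
  have u\<delta>: "0 \<le> u * \<delta>" "u * \<delta> \<le> \<delta>" using u \<delta> by (auto simp: mult_left_le_one_le)
  have L1: "0 \<le> L" using u\<delta> by (simp add: L_def)
  have L2: "L \<le> u * \<delta>" unfolding L_def by (rule ln_add_one_self_le_self[OF u\<delta>(1)])
  have L3: "u * \<delta> - L \<le> \<delta> * \<delta>"
  proof -
    have "- L = ln (1 / (1 + u * \<delta>))" using u\<delta> by (simp add: L_def ln_div)
    also have "\<dots> \<le> 1 / (1 + u * \<delta>) - 1" using u\<delta> by (intro ln_le_minus_one) auto
    finally have "u * \<delta> - L \<le> u * \<delta> + 1 / (1 + u * \<delta>) - 1" by simp
    also have "\<dots> = (u * \<delta>) * (u * \<delta>) / (1 + u * \<delta>)" using u\<delta> by (simp add: field_simps)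
    also have "\<dots> \<le> (u * \<delta>) * (u * \<delta>) / 1" using u\<delta> by (intro divide_left_mono) auto
    also have "\<dots> = (u * \<delta>) * (u * \<delta>)" by simp
    also have "\<dots> \<le> \<delta> * \<delta>" using u\<delta> by (intro mult_mono) auto
    finally show ?thesis .
  qed
  have t': "\<bar>Im s\<bar> * \<delta> \<le> 2 * pi" using t by (simp add: \<delta>_def)
  have n\<eta>: "norm \<eta> \<le> (S + 2 * pi) * \<delta>"
  proof -
    have "norm \<eta> \<le> norm (complex_of_real (Re s * L)) + norm (\<i> * complex_of_real (Im s * (L - u * \<delta>)))"
      unfolding \<eta>_def by (metis norm_minus_cancel norm_triangle_ineq4)
    also have "\<dots> = \<bar>Re s\<bar> * L + \<bar>Im s\<bar> * (u * \<delta> - L)"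
      using L1 L2 by (simp add: norm_mult abs_mult del: of_real_mult of_real_diff)
    also have "\<dots> \<le> S * \<delta> + \<bar>Im s\<bar> * (\<delta> * \<delta>)"
      using L1 L2 L3 u\<delta> \<sigma> by (intro add_mono mult_mono) auto
    also have "\<bar>Im s\<bar> * (\<delta> * \<delta>) \<le> 2 * pi * \<delta>"
      using mult_right_mono[OF t' less_imp_le[OF \<delta>]] by (simp add: mult.assoc)
    finally show ?thesis by (simp add: algebra_simps)
  qed
  have "complex_of_real (y + u * v) powr (-s) = exp (- s * of_real (ln (y + u * v)))"
  proof -
    have "y + u * v > 0" using y u v by (simp add: add_pos_nonneg)
    then show ?thesis by (simp add: powr_def Ln_of_real flip: of_real_add of_real_mult)
  qed
  also have "ln (y + u * v) = ln y + L"
  proof -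
    have "y + u * v = y * (1 + u * \<delta>)" using y by (simp add: \<delta>_def field_simps)
    moreover have "1 + u * \<delta> > 0" using u\<delta> by simp
    ultimately show ?thesis using y by (simp add: L_def ln_mult)
  qed
  also have "exp (- s * of_real (ln y + L)) = complex_of_real y powr (-s) * exp (- s * of_real L)"
    using y by (simp add: powr_def Ln_of_real exp_add[symmetric] algebra_simps)
  also have "- s * of_real L = z + \<eta>"
    by (simp add: z_def \<eta>_def complex_eq_iff \<delta>_def algebra_simps)
  finally have "norm (complex_of_real (y + u * v) powr (-s) - complex_of_real y powr (-s) * exp z) =
      norm (complex_of_real y powr (-s) * (exp z * (exp \<eta> - 1)))"
    by (simp add: exp_add algebra_simps)
  also have "\<dots> = y powr (- Re s) * norm (exp \<eta> - 1)"
    using y by (simp add: norm_mult norm_of_real_powr norm_exp_eq_Re z_def)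
  also have "norm (exp \<eta> - 1) \<le> norm \<eta> * exp (norm \<eta>)" by (rule norm_exp_minus_1_le)
  also have "\<dots> \<le> ((S + 2 * pi) * \<delta>) * exp ((S + 2 * pi) * \<delta>)"
    using n\<eta> order_trans[OF norm_ge_zero n\<eta>] by (intro mult_mono) auto
  finally show ?thesis
    using y by (simp add: z_def \<delta>_def mult_ac mult_left_mono)
qed

text \<open>The preceding estimate integrated over \<open>u\<close> from 0 to 1. \<open>D\<close> is
  the difference of the two primitives, so its derivative is the quantity already bounded. The case
  \<open>z = 0\<close> is a constant phase, whose integral is 1.\<close>

lemma powr_integral_eq_phase:
  fixes S :: real
  assumes y: "y > 0" and v: "v > 0" and \<sigma>: "\<bar>Re s\<bar> \<le> S" and t: "\<bar>Im s\<bar> * v / y \<le> 2 * pi"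
    and s: "s \<noteq> 1"
  defines "z \<equiv> - (\<i> * complex_of_real (Im s * v / y))"
  shows "norm ((complex_of_real y powr (1 - s) - complex_of_real (y + v) powr (1 - s)) / (of_real v * (s - 1))
            - complex_of_real y powr (-s) * (if z = 0 then 1 else (exp z - 1) / z))
         \<le> (S + 2 * pi) * exp ((S + 2 * pi) * (v / y)) * (v / y) * y powr (- Re s)"
proof -
  define \<phi> where "\<phi> = (\<lambda>u. if z = 0 then u else (exp (z * u) - 1) / z)"
  define D where "D = (\<lambda>u. (complex_of_real y powr (1 - s) - (of_real y + u * of_real v) powr (1 - s))
      / (of_real v * (s - 1)) - complex_of_real y powr (-s) * \<phi> u)"
  define T where "T = closed_segment (0::complex) 1"
  have T: "\<exists>\<xi>. u = of_real \<xi> \<and> 0 \<le> \<xi> \<and> \<xi> \<le> 1" if "u \<in> T" for u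
    using that closed_segment_of_real[of 0 1, where ?'a = complex]
    by (auto simp: T_def closed_segment_eq_real_ivl)
  have "norm (D 1 - D 0) \<le> (S + 2 * pi) * exp ((S + 2 * pi) * (v / y)) * (v / y) * y powr (- Re s)
       * norm (1 - 0 :: complex)"
  proof (rule field_differentiable_bound[of T D])
    show "convex T" by (simp add: T_def)
    fix u assume "u \<in> T"
    then obtain \<xi> where xi: "u = of_real \<xi>" "0 \<le> \<xi>" "\<xi> \<le> 1" using T by blast
    have pos: "y + \<xi> * v > 0" using y v xi by (simp add: add_pos_nonneg)
    have nn: "of_real y + u * of_real v \<notin> \<real>\<^sub>\<le>\<^sub>0"
      using pos by (simp add: xi complex_nonpos_Reals_iff)
    have d\<phi>: "(\<phi> has_field_derivative exp (z * u)) (at u within T)"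
    proof (cases "z = 0")
      case True
      then show ?thesis by (simp add: \<phi>_def)
    next
      case False
      then show ?thesis unfolding \<phi>_def by (auto intro!: derivative_eq_intros)
    qed
    have dA: "((\<lambda>u. (of_real y + u * of_real v) powr (1 - s)) has_field_derivative
       (1 - s) * (of_real y + u * of_real v) powr (1 - s - 1) * of_real v) (at u within T)"
      using nn by (auto intro!: derivative_eq_intros simp: algebra_simps)
    have "(D has_field_derivative ((0 - (1 - s) * (of_real y + u * of_real v) powr (1 - s - 1) * of_real v)
         / (of_real v * (s - 1)) - complex_of_real y powr (-s) * exp (z * u))) (at u within T)"
      unfolding D_def by (intro DERIV_diff DERIV_cdivide DERIV_cmult DERIV_const dA d\<phi>)
    also have "(0 - (1 - s) * (of_real y + u * of_real v) powr (1 - s - 1) * of_real v) / (of_real v * (s - 1))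
         = (of_real y + u * of_real v) powr (-s)"
    proof -
      have "0 - (1 - s) * (of_real y + u * of_real v) powr (1 - s - 1) * of_real v
          = (of_real y + u * of_real v) powr (-s) * (of_real v * (s - 1))"
        by (simp add: algebra_simps)
      then show ?thesis using v s by simp
    qed
    finally show "(D has_field_derivative ((of_real y + u * of_real v) powr (-s)
         - complex_of_real y powr (-s) * exp (z * u))) (at u within T)" .
    show "norm ((of_real y + u * of_real v) powr (-s) - complex_of_real y powr (-s) * exp (z * u))
      \<le> (S + 2 * pi) * exp ((S + 2 * pi) * (v / y)) * (v / y) * y powr (- Re s)"
      using powr_shift_eq_phase[OF y v \<sigma> t xi(2,3)] by (simp add: xi z_def)
  qed (auto simp: T_def)
  moreover have "D 0 = 0" by (simp add: D_def \<phi>_def)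
  moreover have "D 1 = (complex_of_real y powr (1 - s) - complex_of_real (y + v) powr (1 - s)) / (of_real v * (s - 1))
            - complex_of_real y powr (-s) * (if z = 0 then 1 else (exp z - 1) / z)"
    by (simp add: D_def \<phi>_def)
  ultimately show ?thesis by simp
qed

section \<open>Remainder sums along one direction\<close>

text \<open>Divided by \<open>of_real v * (s - 1)\<close>, this is the summand at \<open>y\<close>
  minus the average of \<open>x powr (-s)\<close> over the interval from \<open>y\<close> to
  \<open>y + v\<close>.\<close>

lemma powr_taylor_rem_2:
  "powr_taylor_rem 2 v y s = complex_of_real (y + v) powr (1 - s) - complex_of_real y powr (1 - s)
    + of_real v * (s - 1) * complex_of_real y powr (-s)"
  by (simp add: powr_taylor_rem_def numeral_2_eq_2)

text \<open>The telescoping primitive \<open>G\<close> is correct up to an error that is smaller by a full factor \<open>1 / y\<close>,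
  uniformly in the phase \<open>t v / y\<close> as long as it stays away from \<open>\<plusminus> 2 \<pi>\<close>.\<close>

lemma powr_taylor_rem_telescope:
  fixes v y0 C S :: real
  assumes v: "v > 0" and y0: "y0 > 0" and C: "C > 1" and S: "S \<ge> 0"
  shows "\<exists>G K. K \<ge> 0 \<and> (\<forall>y s. y \<ge> y0 \<longrightarrow> \<bar>Re s\<bar> \<le> S \<longrightarrow> \<bar>Im s\<bar> * v \<le> 2 * pi * y / C \<longrightarrow> s \<noteq> 1 \<longrightarrow>
     norm (G s y) \<le> K * y powr (- Re s) \<and>
     norm (powr_taylor_rem 2 v y s / (of_real v * (s - 1)) - (G s y - G s (y + v)))
       \<le> K * y powr (- Re s - 1))"
proof -
  \<comment> \<open>The largest phase that can occur. It is below \<open>2 * pi\<close> because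
    \<open>C > 1\<close>, so the kernel is bounded and Lipschitz on the disc of radius
    \<open>c\<close>.\<close>
  define c where "c = 2 * pi / C"
  have c: "c < 2 * pi" "c > 0" using C by (auto simp: c_def field_simps)
  obtain Q B where B: "B \<ge> 0" and QB: "\<And>z. norm z \<le> c \<Longrightarrow> norm (Q z) \<le> B"
    and QL: "\<And>z z'. norm z \<le> c \<Longrightarrow> norm z' \<le> c \<Longrightarrow> norm (Q z - Q z') \<le> B * norm (z - z')"
    and QI: "\<And>z. norm z \<le> c \<Longrightarrow> z \<noteq> 0 \<Longrightarrow> 1 - (exp z - 1) / z = Q z * (1 - exp z :: complex)"
    using ex_exp_difference_kernel[OF c(1)] by metis
  define K1 where "K1 = (S + 2 * pi) * exp ((S + 2 * pi) * (v / y0)) * v"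
  have K1: "K1 \<ge> 0" using S v by (simp add: K1_def)
  define \<zeta> where "\<zeta> = (\<lambda>s y. - (\<i> * complex_of_real (Im s * v / y)))"
  define G where "G = (\<lambda>s y. complex_of_real y powr (-s) * Q (\<zeta> s y))"
  \<comment> \<open>\<open>B\<close> serves the size of \<open>G\<close>. The bracket collects three
    errors: of the averaged power, of the shifted power times the kernel, and of the kernel itself
    as its argument moves.\<close>
  define K where "K = B + (K1 + K1 * B + B * c * v)"
  have KB: "B \<le> K" using K1 B c v by (simp add: K_def)
  show ?thesis
  proof (intro exI[of _ G] exI[of _ K] conjI allI impI)
    show "K \<ge> 0" using KB B by simp
    fix y s assume y: "y \<ge> y0" and \<sigma>: "\<bar>Re s\<bar> \<le> S" and t: "\<bar>Im s\<bar> * v \<le> 2 * pi * y / C" and s1: "s \<noteq> (1::complex)"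
    have ypos: "y > 0" using y y0 by simp
    define z where "z = \<zeta> s y"
    define z' where "z' = \<zeta> s (y + v)"
    define \<phi> where "\<phi> = (if z = 0 then 1 else (exp z - 1) / z)"
    define p where "p = complex_of_real y powr (-s)"
    have np: "norm p = y powr (- Re s)" using ypos by (simp add: p_def norm_of_real_powr)
    have nz0: "norm (\<zeta> s Y) = \<bar>Im s\<bar> * v / Y" if "Y > 0" for Y
      using that v by (simp add: \<zeta>_def norm_mult norm_divide abs_mult)
    have tc: "\<bar>Im s\<bar> * v / y \<le> c" using t ypos by (simp add: c_def field_simps)
    have nz: "norm z \<le> c" using tc nz0[OF ypos] by (simp add: z_def)
    have nz': "norm z' \<le> c"
    proof -
      have "\<bar>Im s\<bar> * v / (y + v) \<le> \<bar>Im s\<bar> * v / y"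
        using ypos v by (intro divide_left_mono) auto
      then show ?thesis using tc nz0[of "y + v"] ypos v by (simp add: z'_def)
    qed
    have t2: "\<bar>Im s\<bar> * v / y \<le> 2 * pi" using tc c by simp
    have K1y: "(S + 2 * pi) * exp ((S + 2 * pi) * (v / y)) * (v / y) \<le> K1 / y"
    proof -
      have "exp ((S + 2 * pi) * (v / y)) \<le> exp ((S + 2 * pi) * (v / y0))"
        using S v y y0 by (auto intro!: mult_left_mono divide_left_mono)
      then show ?thesis using S v ypos unfolding K1_def
        by (simp add: divide_right_mono mult_left_mono mult_right_mono)
    qed
    have y1: "y powr (- Re s - 1) = y powr (- Re s) / y"
      using ypos by (simp add: powr_diff)
    have K1y': "(S + 2 * pi) * exp ((S + 2 * pi) * (v / y)) * (v / y) * y powr (- Re s) \<le> K1 * y powr (- Re s - 1)"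
      using mult_right_mono[OF K1y, of "y powr (- Re s)"] by (simp add: y1)
    show "norm (G s y) \<le> K * y powr (- Re s)"
      using mult_mono[OF order_refl[of "norm p"] order_trans[OF QB[OF nz] KB]]
      by (simp add: G_def norm_mult np mult.commute flip: p_def z_def)
    define F where "F = (complex_of_real y powr (1 - s) - complex_of_real (y + v) powr (1 - s)) / (of_real v * (s - 1))"
    define q where "q = complex_of_real (y + v) powr (-s)"
    have e1: "norm (F - p * \<phi>) \<le> K1 * y powr (- Re s - 1)"
      using order_trans[OF powr_integral_eq_phase[OF ypos v \<sigma> t2 s1] K1y']
      by (simp only: F_def p_def \<phi>_def z_def \<zeta>_def)
    have e2: "norm (q - p * exp z) \<le> K1 * y powr (- Re s - 1)"
      using order_trans[OF powr_shift_eq_phase[OF ypos v \<sigma> t2, of 1] K1y']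
      by (simp add: q_def p_def z_def \<zeta>_def)
    \<comment> \<open>The phase changes by only \<open>O(1 / y)\<close> over one step, so the
      Lipschitz bound on \<open>Q\<close> yields the extra factor \<open>1 / y\<close>.\<close>
    have e3: "norm (z' - z) \<le> c * v / y"
    proof -
      have "z' - z = z * of_real (- v / (y + v))"
      proof -
        have "Im s * v / (y + v) - Im s * v / y = (Im s * v / y) * (- v / (y + v))"
          using ypos v by (simp add: divide_simps) (simp add: algebra_simps)
        then have "complex_of_real (Im s * v / (y + v)) - of_real (Im s * v / y)
            = of_real (Im s * v / y) * of_real (- v / (y + v))"
          by (metis of_real_diff of_real_mult)
        moreover have "- (\<i> * a') - - (\<i> * a) = - (\<i> * a) * b" if "a' - a = a * b" for a a' b
        proof -
          have "a' = a + a * b" using that by (simp add: diff_eq_eq add.commute)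
          then show ?thesis by (simp add: algebra_simps)
        qed
        ultimately show ?thesis unfolding z_def z'_def \<zeta>_def by blast
      qed
      then have "norm (z' - z) = norm z * (v / (y + v))"
        using ypos v by (simp add: norm_mult norm_divide flip: of_real_add)
      also have "\<dots> \<le> c * (v / y)"
        using ypos v nz c by (intro mult_mono divide_left_mono) auto
      finally show ?thesis by simp
    qed
    have id: "1 - \<phi> = Q z * (1 - exp z)"
      using QI[OF nz] by (simp add: \<phi>_def)
    have rem: "powr_taylor_rem 2 v y s / (of_real v * (s - 1)) = p - F"
      using v s1 unfolding powr_taylor_rem_2 F_def p_def by (simp add: field_simps)
    \<comment> \<open>An exact decomposition whose last term vanishes by the kernel equation
      \<open>id\<close>.\<close>
    have "p - F - (p * Q z - q * Q z') = - (F - p * \<phi>) + (q - p * exp z) * Q z' + p * exp z * (Q z' - Q z)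
        + p * (1 - \<phi> - Q z * (1 - exp z))"
      by (simp add: algebra_simps)
    then have "norm (p - F - (p * Q z - q * Q z')) = norm (- (F - p * \<phi>) + (q - p * exp z) * Q z' + p * exp z * (Q z' - Q z))"
      unfolding id by (simp only: diff_self mult_zero_right add_0_right)
    also have "\<dots> \<le> norm (F - p * \<phi>) + norm ((q - p * exp z) * Q z') + norm (p * exp z * (Q z' - Q z))"
      by (metis (no_types, lifting) norm_minus_cancel norm_triangle_mono norm_triangle_ineq order_refl)
    also have "\<dots> \<le> K1 * y powr (- Re s - 1) + K1 * y powr (- Re s - 1) * B + y powr (- Re s) * (B * (c * v / y))"
    proof (intro add_mono e1)
      show "norm ((q - p * exp z) * Q z') \<le> K1 * y powr (- Re s - 1) * B"
        unfolding norm_mult using e2 QB[OF nz'] K1 by (intro mult_mono) auto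
      have "norm (exp z) = 1" by (simp add: z_def \<zeta>_def norm_exp_eq_Re)
      moreover have "norm (Q z' - Q z) \<le> B * (c * v / y)"
        by (rule order_trans[OF QL[OF nz' nz] mult_left_mono[OF e3 B]])
      ultimately show "norm (p * exp z * (Q z' - Q z)) \<le> y powr (- Re s) * (B * (c * v / y))"
        unfolding norm_mult np by (metis mult_left_mono mult.right_neutral powr_ge_zero)
    qed
    also have "\<dots> = (K1 + K1 * B + B * c * v) * y powr (- Re s - 1)"
      by (simp add: y1 algebra_simps)
    also have "\<dots> \<le> K * y powr (- Re s - 1)"
      using B by (intro mult_right_mono) (auto simp: K_def)
    finally show "norm (powr_taylor_rem 2 v y s / (of_real v * (s - 1)) - (G s y - G s (y + v)))
       \<le> K * y powr (- Re s - 1)"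
      by (simp add: rem G_def p_def q_def z_def z'_def)
  qed
qed

text \<open>The primitive telescopes to two boundary values. The errors, of exponent
  \<open>Re s + 1 > 1\<close>, sum to the same order \<open>y powr (- Re s)\<close>, independently
  of \<open>N\<close>. The phase condition at \<open>y\<close> implies it at all later
  points.\<close>

lemma norm_powr_taylor_rem_sum_le:
  fixes v y0 C \<sigma>0 \<sigma>1 :: real
  assumes v: "v > 0" and y0: "y0 > 0" and C: "C > 1" and \<sigma>0: "\<sigma>0 > 0"
  shows "\<exists>K\<ge>0. \<forall>y s N. y \<ge> y0 \<longrightarrow> \<sigma>0 \<le> Re s \<longrightarrow> Re s \<le> \<sigma>1 \<longrightarrow> \<bar>Im s\<bar> * v \<le> 2 * pi * y / C \<longrightarrow> s \<noteq> 1 \<longrightarrow>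
     norm (\<Sum>n<N. powr_taylor_rem 2 v (y + real n * v) s / (of_real v * (s - 1))) \<le> K * y powr (- Re s)"
proof -
  define S where "S = \<bar>\<sigma>0\<bar> + \<bar>\<sigma>1\<bar>"
  obtain G K where K: "K \<ge> 0" and G: "\<And>y s. y \<ge> y0 \<Longrightarrow> \<bar>Re s\<bar> \<le> S \<Longrightarrow> \<bar>Im s\<bar> * v \<le> 2 * pi * y / C \<Longrightarrow> s \<noteq> 1 \<Longrightarrow>
     norm (G s y) \<le> K * y powr (- Re s)"
     "\<And>y s. y \<ge> y0 \<Longrightarrow> \<bar>Re s\<bar> \<le> S \<Longrightarrow> \<bar>Im s\<bar> * v \<le> 2 * pi * y / C \<Longrightarrow> s \<noteq> 1 \<Longrightarrow>
     norm (powr_taylor_rem 2 v y s / (of_real v * (s - 1)) - (G s y - G s (y + v)))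
       \<le> K * y powr (- Re s - 1)"
    using powr_taylor_rem_telescope[OF v y0 C, of S] by (auto simp: S_def)
  obtain K2 where K2: "K2 \<ge> 0" and K2b: "\<And>y p. y \<ge> y0 \<Longrightarrow> \<sigma>0 + 1 \<le> p \<Longrightarrow> p \<le> \<sigma>1 + 1 \<Longrightarrow>
           (\<lambda>n. (y + real n * v) powr (-p)) summable_on UNIV \<and>
           (\<Sum>\<^sub>\<infinity>n. (y + real n * v) powr (-p)) \<le> K2 * y powr (1 - p)"
    using powr_sum_bound[OF v y0, of "\<sigma>0 + 1" "\<sigma>1 + 1"] \<sigma>0 by auto
  show ?thesis
  proof (intro exI[of _ "K + K + K * K2"] conjI allI impI)
    fix y s N assume y: "y \<ge> y0" and \<sigma>: "\<sigma>0 \<le> Re s" "Re s \<le> \<sigma>1"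
      and t: "\<bar>Im s\<bar> * v \<le> 2 * pi * y / C" and s1: "s \<noteq> (1::complex)"
    define Y where "Y = (\<lambda>n. y + real n * v)"
    define e where "e = (\<lambda>n. powr_taylor_rem 2 v (Y n) s / (of_real v * (s - 1)))"
    have Yy: "Y n \<ge> y" for n using v by (simp add: Y_def)
    have YS: "Y n + v = Y (Suc n)" for n by (simp add: Y_def algebra_simps)
    have cond: "Y n \<ge> y0" "\<bar>Re s\<bar> \<le> S" "\<bar>Im s\<bar> * v \<le> 2 * pi * Y n / C" for n
    proof -
      show "Y n \<ge> y0" using Yy[of n] y by simp
      show "\<bar>Re s\<bar> \<le> S" using \<sigma> by (auto simp: S_def)
      have "2 * pi * y / C \<le> 2 * pi * Y n / C" using Yy C by (intro divide_right_mono mult_left_mono) auto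
      then show "\<bar>Im s\<bar> * v \<le> 2 * pi * Y n / C" using t by simp
    qed
    have tel: "(\<Sum>n<N. G s (Y n) - G s (Y (Suc n))) = G s (Y 0) - G s (Y N)"
      by (rule sum_lessThan_telescope')
    have "(\<Sum>n<N. e n) = (\<Sum>n<N. e n - (G s (Y n) - G s (Y (Suc n)))) + (G s (Y 0) - G s (Y N))"
      unfolding tel[symmetric] by (simp add: sum_subtractf)
    then have "norm (\<Sum>n<N. e n) \<le> norm (\<Sum>n<N. e n - (G s (Y n) - G s (Y (Suc n)))) + (norm (G s (Y 0)) + norm (G s (Y N)))"
      by (metis norm_triangle_ineq norm_triangle_ineq4 order_trans add_left_mono)
    also have "norm (\<Sum>n<N. e n - (G s (Y n) - G s (Y (Suc n)))) \<le> K * K2 * y powr (- Re s)"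
    proof -
      have "norm (\<Sum>n<N. e n - (G s (Y n) - G s (Y (Suc n)))) \<le> (\<Sum>n<N. K * Y n powr (- (Re s + 1)))"
        using G(2)[OF cond s1] by (intro sum_norm_le) (simp add: e_def YS)
      also have "\<dots> = K * (\<Sum>n<N. Y n powr (- (Re s + 1)))" by (simp add: sum_distrib_left)
      also have "(\<Sum>n<N. Y n powr (- (Re s + 1))) \<le> (\<Sum>\<^sub>\<infinity>n. Y n powr (- (Re s + 1)))"
        using K2b[OF y, of "Re s + 1"] \<sigma> unfolding Y_def by (intro finite_sum_le_infsum) auto
      also have "\<dots> \<le> K2 * y powr (- Re s)"
        using K2b[OF y, of "Re s + 1"] \<sigma> by (simp add: Y_def)
      finally show ?thesis using K by (simp add: mult_left_mono mult.assoc)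
    qed
    also have "norm (G s (Y 0)) \<le> K * y powr (- Re s)"
      using G(1)[OF cond(1)[of 0] cond(2) cond(3)[of 0] s1] by (simp add: Y_def)
    also have "norm (G s (Y N)) \<le> K * y powr (- Re s)"
    proof -
      have "Y N powr (- Re s) \<le> y powr (- Re s)"
        using Yy[of N] y y0 \<sigma> \<sigma>0 by (intro powr_mono2') auto
      then show ?thesis using G(1)[OF cond(1)[of N] cond(2) cond(3)[of N] s1] K by (meson mult_left_mono order_trans)
    qed
    finally show "norm (\<Sum>n<N. powr_taylor_rem 2 v (y + real n * v) s / (of_real v * (s - 1)))
        \<le> (K + K + K * K2) * y powr (- Re s)"
      by (simp add: e_def Y_def algebra_simps)
  qed (use K K2 in simp)
qed

section \<open>The low-frequency approximation\<close>

text \<open>A half-plane without finitely many points is connected, so identities proved by series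
  manipulation extend to the left past the poles.\<close>

lemma barnes_poles_halfplane_continuation:
  assumes f: "f holomorphic_on ({s. Re s > c} - barnes_poles r)"
    and g: "g holomorphic_on ({s. Re s > c} - barnes_poles r)"
    and eq: "\<And>s. Re s > d \<Longrightarrow> f s = g s"
    and s: "Re s > c" "s \<notin> barnes_poles r"
  shows "f s = g s"
proof (rule analytic_continuation_open[of "{s. Re s > max c (max d (real r))}"
      "{s. Re s > c} - barnes_poles r" f g s])
  show "{s. Re s > max c (max d (real r))} \<noteq> {}"
    by (auto intro!: exI[of _ "of_real (max c (max d (real r)) + 1)"])
  show "open ({s. Re s > c} - barnes_poles r)"
    using finite_barnes_poles by (simp add: finite_imp_closed open_Diff open_halfspace_Re_gt)
  show "connected ({s. Re s > c} - barnes_poles r)"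
    by (rule connected_open_delete_finite)
       (auto simp: open_halfspace_Re_gt finite_barnes_poles)
  show "open {s. Re s > max c (max d (real r))}" by (rule open_halfspace_Re_gt)
  show "{s. Re s > max c (max d (real r))} \<subseteq> {s. Re s > c} - barnes_poles r"
    by (auto dest: Re_barnes_poles_le)
qed (use assms in auto)

lemma barnes_poles_shift:
  assumes "s - 1 \<in> barnes_poles r"
  shows "s \<in> barnes_poles (Suc r)"
proof -
  obtain k where "s - 1 = of_nat k" "1 \<le> k" "k \<le> r" using assms by (auto simp: barnes_poles_def)
  then have "s = of_nat (Suc k)" "1 \<le> Suc k" "Suc k \<le> Suc r" by (auto simp: algebra_simps)
  then show ?thesis unfolding barnes_poles_def by blast
qed

lemma barnes_zeta_0:
  assumes "y > 0"
  shows "barnes_zeta 0 y w s = complex_of_real y powr (-s)"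
proof (rule barnes_poles_halfplane_continuation[where r = 0 and c = "Re s - 1" and d = 0
    and f = "barnes_zeta 0 y w" and g = "\<lambda>s. complex_of_real y powr (-s)"])
  show "barnes_zeta 0 y w holomorphic_on {z. Re s - 1 < Re z} - barnes_poles 0"
    using barnes_zeta_holomorphic[of 0 w y] assms by (auto elim: holomorphic_on_subset)
  show "(\<lambda>s. complex_of_real y powr (-s)) holomorphic_on {z. Re s - 1 < Re z} - barnes_poles 0"
    using assms by (auto intro!: holomorphic_intros)
  show "barnes_zeta 0 y w z = complex_of_real y powr (-z)" if "Re z > 0" for z
    using barnes_zeta_eq_series[of 0 w y z] assms that
    by (simp add: barnes_series_alt barnes_idx_0 barnes_lin_def)
qed (auto simp: barnes_poles_def)

text \<open>The Taylor recursion with two terms, continued from \<open>Re s > real r + 2\<close>.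
  The remainder sum converges for \<open>Re s > real r\<close>, and a pole of rank \<open>r\<close>
  at \<open>s - 1\<close> is a pole of rank \<open>r + 1\<close> at \<open>s\<close>.\<close>

lemma barnes_zeta_rec:
  assumes w: "\<forall>i<Suc r. w i > 0" and y: "y > 0" and s: "Re s > real r" "s \<notin> barnes_poles (Suc r)"
  shows "of_real (w r) * (s - 1) * barnes_zeta (Suc r) y w s = barnes_zeta r y w (s - 1)
    + (\<Sum>\<^sub>\<infinity>m\<in>barnes_idx (Suc r). powr_taylor_rem 2 (w r) (y + barnes_lin (Suc r) w m) s)"
proof (rule barnes_poles_halfplane_continuation[where c = "real r" and d = "real r + 2" and r = "Suc r"
    and f = "\<lambda>s. of_real (w r) * (s - 1) * barnes_zeta (Suc r) y w s"
    and g = "\<lambda>s. barnes_zeta r y w (s - 1)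
    + (\<Sum>\<^sub>\<infinity>m\<in>barnes_idx (Suc r). powr_taylor_rem 2 (w r) (y + barnes_lin (Suc r) w m) s)"])
  have w': "\<forall>i<r. w i > 0" using w by simp
  have "barnes_zeta (Suc r) y w holomorphic_on {s. Re s > real r} - barnes_poles (Suc r)"
    using barnes_zeta_holomorphic[OF w y] by (auto elim: holomorphic_on_subset)
  then show "(\<lambda>s. of_real (w r) * (s - 1) * barnes_zeta (Suc r) y w s)
      holomorphic_on {s. Re s > real r} - barnes_poles (Suc r)"
    by (intro holomorphic_intros)
  have "(\<lambda>s. barnes_zeta r y w (s - 1)) holomorphic_on {s. Re s > real r} - barnes_poles (Suc r)"
  proof (rule holomorphic_on_compose_gen[OF _ barnes_zeta_holomorphic[OF w' y], of "\<lambda>s. s - 1", unfolded o_def])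
    show "(\<lambda>s. s - 1) ` ({s. Re s > real r} - barnes_poles (Suc r)) \<subseteq> - barnes_poles r"
      by (auto dest: barnes_poles_shift)
  qed (auto intro!: holomorphic_intros)
  moreover have "(\<lambda>s. \<Sum>\<^sub>\<infinity>m\<in>barnes_idx (Suc r). powr_taylor_rem 2 (w r) (y + barnes_lin (Suc r) w m) s)
       holomorphic_on {s. Re s > real r} - barnes_poles (Suc r)"
    using powr_taylor_rem_sum_holomorphic[OF w y, of "w r" 2] w
    by (auto elim: holomorphic_on_subset)
  ultimately show "(\<lambda>s. barnes_zeta r y w (s - 1)
    + (\<Sum>\<^sub>\<infinity>m\<in>barnes_idx (Suc r). powr_taylor_rem 2 (w r) (y + barnes_lin (Suc r) w m) s))
       holomorphic_on {s. Re s > real r} - barnes_poles (Suc r)"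
    by (intro holomorphic_intros)
  show "of_real (w r) * (s - 1) * barnes_zeta (Suc r) y w s = barnes_zeta r y w (s - 1)
    + (\<Sum>\<^sub>\<infinity>m\<in>barnes_idx (Suc r). powr_taylor_rem 2 (w r) (y + barnes_lin (Suc r) w m) s)"
    if s: "Re s > real r + 2" for s
    using powr_taylor_rem_sum[OF w y s, of 2] barnes_zeta_eq_series[OF w y, of s]
      barnes_zeta_eq_series[OF w' y, of "s - 1"] s
    by (simp add: numeral_2_eq_2)
qed (use s in auto)

text \<open>For \<open>Re s > real r\<close> this is the integral of
  \<open>(y + u.w) powr (-s)\<close> over all nonnegative vectors \<open>u\<close>, that is, the
  series with every sum replaced by an integral.\<close>

definition barnes_main :: "nat \<Rightarrow> real \<Rightarrow> (nat \<Rightarrow> real) \<Rightarrow> complex \<Rightarrow> complex" where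
  "barnes_main r y w s = complex_of_real y powr (of_nat r - s)
     / ((\<Prod>k=1..r. (s - of_nat k)) * complex_of_real (\<Prod>i<r. w i))"

text \<open>The recursion of \<open>barnes_zeta\<close> without the remainder sum, so that
  differences obey a recursion too.\<close>

lemma barnes_main_Suc:
  "barnes_main (Suc r) y w s = barnes_main r y w (s - 1) / (of_real (w r) * (s - 1))"
proof -
  have "(\<Prod>k=1..Suc r. (s - of_nat k)) = (s - 1) * (\<Prod>k=2..Suc r. (s - of_nat k))"
    by (subst prod.atLeast_Suc_atMost) (auto simp: numeral_2_eq_2)
  also have "(\<Prod>k=2..Suc r. (s - of_nat k)) = (\<Prod>k=1..r. (s - 1 - of_nat k))"
    using prod.shift_bounds_cl_Suc_ivl[of "\<lambda>k. s - of_nat k" 1 r]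
    by (simp add: numeral_2_eq_2 algebra_simps)
  finally have P: "(\<Prod>k=1..Suc r. (s - of_nat k)) = (s - 1) * (\<Prod>k=1..r. (s - 1 - of_nat k))" .
  have E: "of_nat (Suc r) - s = of_nat r - (s - 1)" by simp
  show ?thesis unfolding barnes_main_def P E by (simp add: mult_ac)
qed

text \<open>The partial-sum bound in direction \<open>w r\<close> passes to the limit for every
  inner sum; the outer sum over the other \<open>r\<close> indices then converges because
  \<open>\<sigma>0 > real r\<close>.\<close>

lemma norm_powr_taylor_rem_infsum_le:
  fixes y0 \<sigma>0 \<sigma>1 :: real
  assumes w: "\<forall>i<Suc r. w i > 0" and y0: "y0 > 0" and \<sigma>0: "\<sigma>0 > real r"
  shows "\<exists>K\<ge>0. \<forall>y s. y \<ge> y0 \<longrightarrow> \<sigma>0 \<le> Re s \<longrightarrow> Re s \<le> \<sigma>1 \<longrightarrow> \<bar>Im s\<bar> * w r \<le> pi * y \<longrightarrow> s \<noteq> 1 \<longrightarrow>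
    norm (\<Sum>\<^sub>\<infinity>m\<in>barnes_idx (Suc r). powr_taylor_rem 2 (w r) (y + barnes_lin (Suc r) w m) s
       / (of_real (w r) * (s - 1))) \<le> K * y powr (real r - Re s)"
proof -
  have v: "w r > 0" and w': "\<forall>i<r. w i > 0" using w by auto
  have \<sigma>pos: "\<sigma>0 > 0" using \<sigma>0 by linarith
  \<comment> \<open>The choice \<open>C = 2\<close> turns the phase condition into
    \<open>pi * y\<close>.\<close>
  obtain K1 where K1: "K1 \<ge> 0" and K1b: "\<And>y s N. y \<ge> y0 \<Longrightarrow> \<sigma>0 \<le> Re s \<Longrightarrow> Re s \<le> \<sigma>1 \<Longrightarrow>
      \<bar>Im s\<bar> * w r \<le> 2 * pi * y / 2 \<Longrightarrow> s \<noteq> 1 \<Longrightarrow>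
      norm (\<Sum>n<N. powr_taylor_rem 2 (w r) (y + real n * w r) s / (of_real (w r) * (s - 1))) \<le> K1 * y powr (- Re s)"
    using norm_powr_taylor_rem_sum_le[OF v y0 _ \<sigma>pos, of 2 \<sigma>1] by auto
  obtain K2 where K2: "K2 \<ge> 0" and K2b: "\<And>y p. y \<ge> y0 \<Longrightarrow> \<sigma>0 \<le> p \<Longrightarrow> p \<le> \<sigma>1 \<Longrightarrow>
           (\<lambda>m. (y + barnes_lin r w m) powr (-p)) summable_on barnes_idx r \<and>
           (\<Sum>\<^sub>\<infinity>m\<in>barnes_idx r. (y + barnes_lin r w m) powr (-p)) \<le> K2 * y powr (real r - p)"
    using barnes_powr_sum_bound[OF w' y0 \<sigma>0, of \<sigma>1] by blast
  show ?thesis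
  proof (intro exI[of _ "K1 * K2"] conjI allI impI)
    fix y s assume y: "y \<ge> y0" and \<sigma>: "\<sigma>0 \<le> Re s" "Re s \<le> \<sigma>1"
      and t: "\<bar>Im s\<bar> * w r \<le> pi * y" and s1: "s \<noteq> (1::complex)"
    have ypos: "y > 0" using y y0 by simp
    define f where "f = (\<lambda>Y. powr_taylor_rem 2 (w r) Y s / (of_real (w r) * (s - 1)))"
    have "(\<lambda>m. powr_taylor_rem 2 (w r) (y + barnes_lin (Suc r) w m) s) summable_on barnes_idx (Suc r)"
      using \<sigma> \<sigma>0 by (intro powr_taylor_rem_summable[OF w ypos v]) auto
    then have "(\<lambda>m. f (y + barnes_lin (Suc r) w m)) summable_on barnes_idx (Suc r)"
      unfolding f_def divide_inverse by (rule summable_on_cmult_left)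
    note S = barnes_sum_Suc[OF this]
    have E: "norm (\<Sum>\<^sub>\<infinity>n. f (y + barnes_lin r w m + real n * w r)) \<le> K1 * (y + barnes_lin r w m) powr (- Re s)"
      if m: "m \<in> barnes_idx r" for m
    proof -
      define Y where "Y = y + barnes_lin r w m"
      have Y: "Y \<ge> y" using barnes_lin_nonneg[OF w', of m] by (simp add: Y_def)
      have Yt: "\<bar>Im s\<bar> * w r \<le> 2 * pi * Y / 2" using t mult_left_mono[OF Y pi_ge_zero] by linarith
      have "(\<lambda>n. f (Y + real n * w r)) sums (\<Sum>\<^sub>\<infinity>n. f (Y + real n * w r))"
        using S(3)[OF m] by (intro has_sum_imp_sums has_sum_infsum) (simp add: Y_def)
      then have "(\<lambda>N. norm (\<Sum>n<N. f (Y + real n * w r))) \<longlonglongrightarrow> norm (\<Sum>\<^sub>\<infinity>n. f (Y + real n * w r))"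
        unfolding sums_def by (rule tendsto_norm)
      moreover have "norm (\<Sum>n<N. f (Y + real n * w r)) \<le> K1 * Y powr (- Re s)" for N
        unfolding f_def using Y y by (intro K1b \<sigma> Yt s1) auto
      ultimately show ?thesis unfolding Y_def by (intro LIMSEQ_le_const2) auto
    qed
    have "(\<Sum>\<^sub>\<infinity>m\<in>barnes_idx (Suc r). f (y + barnes_lin (Suc r) w m))
        = (\<Sum>\<^sub>\<infinity>m\<in>barnes_idx r. \<Sum>\<^sub>\<infinity>n. f (y + barnes_lin r w m + real n * w r))"
      by (rule S(1))
    also have "norm \<dots> \<le> K1 * (\<Sum>\<^sub>\<infinity>m\<in>barnes_idx r. (y + barnes_lin r w m) powr (- Re s))"
    proof (rule norm_infsum_le)
      show "((\<lambda>m. \<Sum>\<^sub>\<infinity>n. f (y + barnes_lin r w m + real n * w r)) has_sum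
         (\<Sum>\<^sub>\<infinity>m\<in>barnes_idx r. \<Sum>\<^sub>\<infinity>n. f (y + barnes_lin r w m + real n * w r))) (barnes_idx r)"
        by (rule has_sum_infsum[OF S(2)])
      show "((\<lambda>m. K1 * (y + barnes_lin r w m) powr (- Re s)) has_sum
         K1 * (\<Sum>\<^sub>\<infinity>m\<in>barnes_idx r. (y + barnes_lin r w m) powr (- Re s))) (barnes_idx r)"
        using K2b[OF y \<sigma>] by (intro has_sum_cmult_right has_sum_infsum) auto
    qed (rule E)
    also have "\<dots> \<le> K1 * (K2 * y powr (real r - Re s))"
      using K2b[OF y \<sigma>] K1 by (intro mult_left_mono) auto
    finally show "norm (\<Sum>\<^sub>\<infinity>m\<in>barnes_idx (Suc r). powr_taylor_rem 2 (w r) (y + barnes_lin (Suc r) w m) s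
       / (of_real (w r) * (s - 1))) \<le> K1 * K2 * y powr (real r - Re s)"
      by (simp add: f_def mult.assoc)
  qed (use K1 K2 in simp)
qed

lemma barnes_zeta_minus_main_Suc:
  assumes w: "\<forall>i<Suc r. w i > 0" and y: "y > 0" and s: "Re s > real r" "s \<notin> barnes_poles (Suc r)"
  shows "barnes_zeta (Suc r) y w s - barnes_main (Suc r) y w s =
    (barnes_zeta r y w (s - 1) - barnes_main r y w (s - 1)) / (of_real (w r) * (s - 1))
    + (\<Sum>\<^sub>\<infinity>m\<in>barnes_idx (Suc r). powr_taylor_rem 2 (w r) (y + barnes_lin (Suc r) w m) s
       / (of_real (w r) * (s - 1)))"
proof -
  define d where "d = of_real (w r) * (s - 1)"
  have s1: "s \<noteq> 1" using s(2) by (force simp: barnes_poles_def intro: exI[of _ 1])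
  then have d: "d \<noteq> 0" using w by (auto simp: d_def)
  have "(\<Sum>\<^sub>\<infinity>m\<in>barnes_idx (Suc r). powr_taylor_rem 2 (w r) (y + barnes_lin (Suc r) w m) s / d)
      = (\<Sum>\<^sub>\<infinity>m\<in>barnes_idx (Suc r). powr_taylor_rem 2 (w r) (y + barnes_lin (Suc r) w m) s) / d"
    unfolding divide_inverse by (rule infsum_cmult_left')
  moreover have "d * barnes_zeta (Suc r) y w s = barnes_zeta r y w (s - 1)
    + (\<Sum>\<^sub>\<infinity>m\<in>barnes_idx (Suc r). powr_taylor_rem 2 (w r) (y + barnes_lin (Suc r) w m) s)"
    unfolding d_def by (rule barnes_zeta_rec[OF w y s])
  ultimately show ?thesis
    using d unfolding barnes_main_Suc d_def[symmetric] by (simp add: field_simps)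
qed

text \<open>Induction on the rank, replacing one sum by an integral at a time. Passing to
  \<open>s - 1\<close> and rank \<open>r\<close> leaves the exponent of the error unchanged, so both
  parts of the recursion have the required order.\<close>

lemma barnes_zeta_low_frequency:
  fixes y0 \<sigma>0 \<sigma>1 :: real
  assumes "r \<ge> 1" and "\<forall>i<r. w i > 0" and y0: "y0 > 0" and "\<sigma>0 > real r - 1"
  shows "\<exists>K\<ge>0. \<forall>y s. y \<ge> y0 \<longrightarrow> \<sigma>0 \<le> Re s \<longrightarrow> Re s \<le> \<sigma>1 \<longrightarrow> (\<forall>i<r. \<bar>Im s\<bar> * w i \<le> pi * y) \<longrightarrow>
    s \<notin> barnes_poles r \<longrightarrow>
    norm (barnes_zeta r y w s - barnes_main r y w s) \<le> K * y powr (real r - 1 - Re s)"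
  using assms(1,2,4)
proof (induction r arbitrary: \<sigma>0 \<sigma>1)
  case (Suc r)
  have w: "\<forall>i<Suc r. w i > 0" and \<sigma>0: "\<sigma>0 > real r" using Suc.prems by auto
  have v: "w r > 0" using w by simp
  obtain K1 where K1: "K1 \<ge> 0" and K1b: "\<And>y s. y \<ge> y0 \<Longrightarrow> \<sigma>0 \<le> Re s \<Longrightarrow> Re s \<le> \<sigma>1 \<Longrightarrow>
    \<bar>Im s\<bar> * w r \<le> pi * y \<Longrightarrow> s \<noteq> 1 \<Longrightarrow>
    norm (\<Sum>\<^sub>\<infinity>m\<in>barnes_idx (Suc r). powr_taylor_rem 2 (w r) (y + barnes_lin (Suc r) w m) s
       / (of_real (w r) * (s - 1))) \<le> K1 * y powr (real r - Re s)"
    using norm_powr_taylor_rem_infsum_le[OF w y0 \<sigma>0, of \<sigma>1] by blast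
  have "\<exists>K2\<ge>0. \<forall>y s. y \<ge> y0 \<longrightarrow> \<sigma>0 \<le> Re s \<longrightarrow> Re s \<le> \<sigma>1 \<longrightarrow> (\<forall>i<Suc r. \<bar>Im s\<bar> * w i \<le> pi * y) \<longrightarrow>
    s \<notin> barnes_poles (Suc r) \<longrightarrow>
    norm ((barnes_zeta r y w (s - 1) - barnes_main r y w (s - 1)) / (of_real (w r) * (s - 1)))
      \<le> K2 * y powr (real r - Re s)"
  \<comment> \<open>In rank 0 the error is exactly 0, while \<open>s\<close> may come arbitrarily
    close to 1. For larger \<open>r\<close> the factor \<open>s - 1\<close> is bounded away from 0,
    since \<open>\<sigma>0 > real r\<close>.\<close>
  proof (cases "r = 0")
    case True
    have "barnes_zeta r y w s = barnes_main r y w s" if "y \<ge> y0" for y s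
      using that y0 True by (simp add: barnes_zeta_0 barnes_main_def)
    then show ?thesis by (intro exI[of _ 0]) auto
  next
    case False
    obtain K where K: "K \<ge> 0" and Kb: "\<And>y s. y \<ge> y0 \<Longrightarrow> \<sigma>0 - 1 \<le> Re s \<Longrightarrow> Re s \<le> \<sigma>1 - 1 \<Longrightarrow>
      (\<forall>i<r. \<bar>Im s\<bar> * w i \<le> pi * y) \<Longrightarrow> s \<notin> barnes_poles r \<Longrightarrow>
      norm (barnes_zeta r y w s - barnes_main r y w s) \<le> K * y powr (real r - 1 - Re s)"
      using Suc.IH[of "\<sigma>0 - 1" "\<sigma>1 - 1"] False w \<sigma>0 by auto
    show ?thesis
    proof (intro exI[of _ "K / (w r * (\<sigma>0 - 1))"] conjI allI impI)
      have \<sigma>1': "\<sigma>0 - 1 > 0" using \<sigma>0 False by linarith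
      then show "K / (w r * (\<sigma>0 - 1)) \<ge> 0" using K v by simp
      fix y s assume y: "y \<ge> y0" and \<sigma>: "\<sigma>0 \<le> Re s" "Re s \<le> \<sigma>1"
        and t: "\<forall>i<Suc r. \<bar>Im s\<bar> * w i \<le> pi * y" and s: "s \<notin> barnes_poles (Suc r)"
      have "s - 1 \<notin> barnes_poles r" using s barnes_poles_shift by blast
      then have A: "norm (barnes_zeta r y w (s - 1) - barnes_main r y w (s - 1)) \<le> K * y powr (real r - Re s)"
        using Kb[of y "s - 1"] y \<sigma> t by simp
      have B: "w r * (\<sigma>0 - 1) \<le> norm (of_real (w r) * (s - 1))"
        using complex_Re_le_cmod[of "s - 1"] \<sigma> v by (simp add: norm_mult)
      have "norm ((barnes_zeta r y w (s - 1) - barnes_main r y w (s - 1)) / (of_real (w r) * (s - 1)))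
         \<le> K * y powr (real r - Re s) / (w r * (\<sigma>0 - 1))"
        unfolding norm_divide using A B K v \<sigma>1' by (intro frac_le) auto
      then show "norm ((barnes_zeta r y w (s - 1) - barnes_main r y w (s - 1)) / (of_real (w r) * (s - 1)))
         \<le> K / (w r * (\<sigma>0 - 1)) * y powr (real r - Re s)" by simp
    qed
  qed
  then obtain K2 where K2: "K2 \<ge> 0" and K2b: "\<And>y s. y \<ge> y0 \<Longrightarrow> \<sigma>0 \<le> Re s \<Longrightarrow> Re s \<le> \<sigma>1 \<Longrightarrow>
    (\<forall>i<Suc r. \<bar>Im s\<bar> * w i \<le> pi * y) \<Longrightarrow> s \<notin> barnes_poles (Suc r) \<Longrightarrow>
    norm ((barnes_zeta r y w (s - 1) - barnes_main r y w (s - 1)) / (of_real (w r) * (s - 1)))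
      \<le> K2 * y powr (real r - Re s)" by blast
  show ?case
  proof (intro exI[of _ "K2 + K1"] conjI allI impI)
    fix y s assume y: "y \<ge> y0" and \<sigma>: "\<sigma>0 \<le> Re s" "Re s \<le> \<sigma>1"
      and t: "\<forall>i<Suc r. \<bar>Im s\<bar> * w i \<le> pi * y" and s: "s \<notin> barnes_poles (Suc r)"
    have s1: "s \<noteq> 1" using s by (force simp: barnes_poles_def intro: exI[of _ 1])
    have "barnes_zeta (Suc r) y w s - barnes_main (Suc r) y w s =
      (barnes_zeta r y w (s - 1) - barnes_main r y w (s - 1)) / (of_real (w r) * (s - 1))
      + (\<Sum>\<^sub>\<infinity>m\<in>barnes_idx (Suc r). powr_taylor_rem 2 (w r) (y + barnes_lin (Suc r) w m) s
       / (of_real (w r) * (s - 1)))"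
      using y y0 \<sigma> \<sigma>0 by (intro barnes_zeta_minus_main_Suc w s) auto
    also have "norm \<dots> \<le> K2 * y powr (real r - Re s) + K1 * y powr (real r - Re s)"
      using K2b[OF y \<sigma> t s] K1b[OF y \<sigma> _ s1] t by (intro norm_triangle_mono) auto
    finally show "norm (barnes_zeta (Suc r) y w s - barnes_main (Suc r) y w s)
        \<le> (K2 + K1) * y powr (real (Suc r) - 1 - Re s)"
      by (simp add: algebra_simps)
  qed (use K1 K2 in simp)
qed simp

section \<open>Truncation to a box\<close>

text \<open>Inclusion-exclusion, obtained by expanding the product of \<open>1 - ch i\<close> over
  all coordinates.\<close>

lemma sum_Pow_indicator:
  fixes r L :: nat and m :: "nat \<Rightarrow> nat"
  shows "(\<Sum>I\<in>Pow {..<r}. (-1) ^ card I * (if \<forall>i\<in>I. L \<le> m i then 1 else 0)) =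
     (if \<forall>i<r. m i < L then 1 else (0::complex))"
proof -
  define ch :: "nat \<Rightarrow> complex" where "ch = (\<lambda>i. if L \<le> m i then 1 else 0)"
  have ind: "(\<Prod>i\<in>I. ch i) = (if \<forall>i\<in>I. L \<le> m i then 1 else 0)" if "finite I" for I
    using that by (induction I) (auto simp: ch_def)
  have "(\<Sum>I\<in>Pow {..<r}. (-1) ^ card I * (if \<forall>i\<in>I. L \<le> m i then 1 else 0)) =
     (\<Sum>I\<in>Pow {..<r}. (\<Prod>i\<in>I. - ch i) * (\<Prod>i\<in>{..<r} - I. 1))"
    by (intro sum.cong) (auto simp: prod_uminus ind finite_subset)
  also have "\<dots> = (\<Prod>i<r. - ch i + 1)"
    by (rule prod_add[symmetric]) simp
  also have "\<dots> = (if \<forall>i<r. m i < L then 1 else 0)"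
  proof (cases "\<forall>i<r. m i < L")
    case True
    then show ?thesis by (auto simp: ch_def intro!: prod.neutral)
  next
    case False
    then obtain i where "i < r" "L \<le> m i" by auto
    then show ?thesis using False by (auto simp: ch_def intro!: prod_zero)
  qed
  finally show ?thesis .
qed

lemma finite_barnes_box: "finite {m \<in> barnes_idx r. \<forall>i<r. m i < L}" for L :: nat
proof (rule finite_subset)
  show "{m \<in> barnes_idx r. \<forall>i<r. m i < L} \<subseteq> {f. \<forall>i. (i \<in> {..<r} \<longrightarrow> f i \<in> {..<L}) \<and> (i \<notin> {..<r} \<longrightarrow> f i = 0)}"
    by (auto simp: barnes_idx_def)
  show "finite {f. \<forall>i. (i \<in> {..<r} \<longrightarrow> f i \<in> {..<L}) \<and> (i \<notin> {..<r} \<longrightarrow> f i = (0::nat))}"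
    by (rule finite_set_of_finite_funs) auto
qed

text \<open>Adding \<open>L\<close> to the coordinates in \<open>I\<close> is a bijection onto the
  vectors that are at least \<open>L\<close> there. Extension by 0 puts all \<open>I\<close> on the
  same index set, ready for inclusion-exclusion under the sum.\<close>

lemma barnes_series_shifted_has_sum:
  fixes L :: nat
  assumes w: "\<forall>i<r. w i > 0" and y: "y > 0" and s: "Re s > real r" and I: "I \<subseteq> {..<r}"
  shows "((\<lambda>m. if \<forall>i\<in>I. L \<le> m i then complex_of_real (y + barnes_lin r w m) powr (-s) else 0)
     has_sum barnes_series r (y + real L * (\<Sum>i\<in>I. w i)) w s) (barnes_idx r)"
proof -
  define f where "f = (\<lambda>m. complex_of_real (y + barnes_lin r w m) powr (-s))"
  define y' where "y' = y + real L * (\<Sum>i\<in>I. w i)"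
  define h where "h = (\<lambda>m i. if i \<in> I then m i + L else m i)"
  have "(\<Sum>i\<in>I. w i) \<ge> 0" using w I by (intro sum_nonneg) (auto intro: less_imp_le)
  then have y': "y' > 0" using y by (simp add: y'_def add_pos_nonneg)
  have lin: "y + barnes_lin r w (h m) = y' + barnes_lin r w m" for m
  proof -
    have "barnes_lin r w (h m) = (\<Sum>i<r. real (m i) * w i + (if i \<in> I then real L * w i else 0))"
      unfolding barnes_lin_def h_def by (intro sum.cong) (auto simp: algebra_simps)
    also have "\<dots> = barnes_lin r w m + (\<Sum>i\<in>{..<r} \<inter> I. real L * w i)"
      by (simp add: sum.distrib barnes_lin_def sum.inter_restrict)
    also have "{..<r} \<inter> I = I" using I by auto
    finally show ?thesis by (simp add: y'_def sum_distrib_left)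
  qed
  have bij: "bij_betw h (barnes_idx r) {m \<in> barnes_idx r. \<forall>i\<in>I. L \<le> m i}"
    by (rule bij_betwI[where g = "\<lambda>m i. if i \<in> I then m i - L else m i"])
       (use I in \<open>auto simp: h_def barnes_idx_def fun_eq_iff\<close>)
  have "((\<lambda>m. complex_of_real (y' + barnes_lin r w m) powr (-s)) has_sum barnes_series r y' w s) (barnes_idx r)"
    using barnes_series_summable[OF w y' s] by (simp add: barnes_series_alt)
  then have "((\<lambda>m. f (h m)) has_sum barnes_series r y' w s) (barnes_idx r)"
    by (simp only: f_def lin)
  then have "(f has_sum barnes_series r y' w s) {m \<in> barnes_idx r. \<forall>i\<in>I. L \<le> m i}"
    by (simp only: has_sum_reindex_bij_betw[OF bij])
  also have "?this \<longleftrightarrow> ((\<lambda>m. if \<forall>i\<in>I. L \<le> m i then f m else 0) has_sum barnes_series r y' w s) (barnes_idx r)"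
    by (rule has_sum_cong_neutral) auto
  finally show ?thesis unfolding f_def y'_def .
qed

lemma barnes_series_box:
  fixes L :: nat
  assumes w: "\<forall>i<r. w i > 0" and y: "y > 0" and s: "Re s > real r"
  shows "(\<Sum>I\<in>Pow {..<r}. (-1) ^ card I * barnes_series r (y + real L * (\<Sum>i\<in>I. w i)) w s)
    = (\<Sum>m\<in>{m \<in> barnes_idx r. \<forall>i<r. m i < L}. complex_of_real (y + barnes_lin r w m) powr (-s))"
proof -
  define f where "f = (\<lambda>m. complex_of_real (y + barnes_lin r w m) powr (-s))"
  have "((\<lambda>m. \<Sum>I\<in>Pow {..<r}. (-1) ^ card I * (if \<forall>i\<in>I. L \<le> m i then f m else 0)) has_sum
      (\<Sum>I\<in>Pow {..<r}. (-1) ^ card I * barnes_series r (y + real L * (\<Sum>i\<in>I. w i)) w s)) (barnes_idx r)"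
    unfolding f_def by (intro has_sum_finite_sum has_sum_cmult_right barnes_series_shifted_has_sum w y s) auto
  moreover have "(\<Sum>I\<in>Pow {..<r}. (-1) ^ card I * (if \<forall>i\<in>I. L \<le> m i then f m else 0))
      = (if \<forall>i<r. m i < L then f m else 0)" for m
  proof -
    have "(\<Sum>I\<in>Pow {..<r}. (-1) ^ card I * (if \<forall>i\<in>I. L \<le> m i then f m else 0)) =
      (\<Sum>I\<in>Pow {..<r}. (-1) ^ card I * (if \<forall>i\<in>I. L \<le> m i then 1 else 0)) * f m"
      unfolding sum_distrib_right by (intro sum.cong) auto
    then show ?thesis unfolding sum_Pow_indicator by auto
  qed
  ultimately have "((\<lambda>m. if \<forall>i<r. m i < L then f m else 0) has_sum
      (\<Sum>I\<in>Pow {..<r}. (-1) ^ card I * barnes_series r (y + real L * (\<Sum>i\<in>I. w i)) w s)) (barnes_idx r)"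
    by simp
  also have "?this \<longleftrightarrow> (f has_sum
      (\<Sum>I\<in>Pow {..<r}. (-1) ^ card I * barnes_series r (y + real L * (\<Sum>i\<in>I. w i)) w s))
      {m \<in> barnes_idx r. \<forall>i<r. m i < L}"
    by (rule has_sum_cong_neutral) auto
  finally show ?thesis
    using has_sum_unique has_sum_finite[OF finite_barnes_box] unfolding f_def by blast
qed

text \<open>Inclusion-exclusion for the series, continued off the poles and solved for the term with
  empty \<open>I\<close>. The box sum is finite and therefore entire in \<open>s\<close>.\<close>

lemma barnes_zeta_box:
  fixes L :: nat
  assumes w: "\<forall>i<r. w i > 0" and y: "y > 0" and s: "s \<notin> barnes_poles r"
  shows "barnes_zeta r y w s =
    (\<Sum>m\<in>{m \<in> barnes_idx r. \<forall>i<r. m i < L}. complex_of_real (y + barnes_lin r w m) powr (-s))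
    - (\<Sum>I\<in>{I. I \<subseteq> {..<r} \<and> I \<noteq> {}}. (-1) ^ card I * barnes_zeta r (y + real L * (\<Sum>i\<in>I. w i)) w s)"
proof -
  \<comment> \<open>Any bound below \<open>Re s\<close> would do; it only places \<open>s\<close>
    inside the half-plane of the continuation argument.\<close>
  define c where "c = Re s - 1"
  have pos: "y + real L * (\<Sum>i\<in>I. w i) > 0" if "I \<subseteq> {..<r}" for I
  proof -
    have "(\<Sum>i\<in>I. w i) \<ge> 0" using w that by (intro sum_nonneg) (auto intro: less_imp_le)
    then show ?thesis using y by (simp add: add_pos_nonneg)
  qed
  have "(\<Sum>I\<in>Pow {..<r}. (-1) ^ card I * barnes_zeta r (y + real L * (\<Sum>i\<in>I. w i)) w s)
    = (\<Sum>m\<in>{m \<in> barnes_idx r. \<forall>i<r. m i < L}. complex_of_real (y + barnes_lin r w m) powr (-s))"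
  proof (rule barnes_poles_halfplane_continuation[where c = c and d = "real r" and r = r
      and f = "\<lambda>s. \<Sum>I\<in>Pow {..<r}. (-1) ^ card I * barnes_zeta r (y + real L * (\<Sum>i\<in>I. w i)) w s"
      and g = "\<lambda>s. \<Sum>m\<in>{m \<in> barnes_idx r. \<forall>i<r. m i < L}. complex_of_real (y + barnes_lin r w m) powr (-s)"])
    have "barnes_zeta r (y + real L * (\<Sum>i\<in>I. w i)) w holomorphic_on ({s. Re s > c} - barnes_poles r)"
      if "I \<in> Pow {..<r}" for I
      by (rule holomorphic_on_subset[OF barnes_zeta_holomorphic[OF w pos]]) (use that in auto)
    then show "(\<lambda>s. \<Sum>I\<in>Pow {..<r}. (-1) ^ card I * barnes_zeta r (y + real L * (\<Sum>i\<in>I. w i)) w s)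
        holomorphic_on ({s. Re s > c} - barnes_poles r)"
      by (intro holomorphic_intros)
    show "(\<lambda>s. \<Sum>m\<in>{m \<in> barnes_idx r. \<forall>i<r. m i < L}. complex_of_real (y + barnes_lin r w m) powr (-s))
        holomorphic_on ({s. Re s > c} - barnes_poles r)"
      by (intro holomorphic_intros)
    show "(\<Sum>I\<in>Pow {..<r}. (-1) ^ card I * barnes_zeta r (y + real L * (\<Sum>i\<in>I. w i)) w s)
    = (\<Sum>m\<in>{m \<in> barnes_idx r. \<forall>i<r. m i < L}. complex_of_real (y + barnes_lin r w m) powr (-s))"
      if "Re s > real r" for s
      unfolding barnes_series_box[OF w y that, symmetric]
      by (intro sum.cong refl) (simp add: barnes_zeta_eq_series[OF w pos that])
  qed (use s in \<open>auto simp: c_def\<close>)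
  moreover have "Pow {..<r} = insert {} {I. I \<subseteq> {..<r} \<and> I \<noteq> {}}" by auto
  moreover have "finite {I. I \<subseteq> {..<r} \<and> I \<noteq> {}}" by (rule finite_subset[of _ "Pow {..<r}"]) auto
  ultimately show ?thesis by (simp add: algebra_simps)
qed

section \<open>High frequencies\<close>

text \<open>The factors with \<open>k < r\<close> have real part at least
  \<open>\<sigma>0 - (real r - 1)\<close>. The last one may be small near the pole \<open>r\<close>
  and is kept.\<close>

lemma norm_prod_poles_ge:
  assumes r: "r \<ge> 1" and s: "Re s \<ge> \<sigma>0" and \<sigma>0: "\<sigma>0 > real r - 1"
  shows "(\<sigma>0 - (real r - 1)) ^ (r - 1) * norm (s - of_nat r) \<le> norm (\<Prod>k=1..r. (s - of_nat k))"
proof -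
  obtain q where q: "r = Suc q" using r by (cases r) auto
  have "(\<Prod>k=1..q. \<sigma>0 - (real r - 1)) \<le> (\<Prod>k=1..q. norm (s - of_nat k))"
  proof (intro prod_mono conjI)
    fix k assume k: "k \<in> {1..q}"
    have "\<sigma>0 - (real r - 1) \<le> Re (s - of_nat k)" using k s by (simp add: q)
    also have "\<dots> \<le> norm (s - of_nat k)" by (rule complex_Re_le_cmod)
    finally show "\<sigma>0 - (real r - 1) \<le> norm (s - of_nat k)" .
  qed (use \<sigma>0 in simp)
  then show ?thesis by (simp add: q norm_mult prod_norm mult_right_mono)
qed

text \<open>A large imaginary part makes the factor \<open>s - of_nat r\<close> at least of order
  \<open>y\<close>, which gains the missing power.\<close>

lemma norm_barnes_main_le:
  assumes r: "r \<ge> 1" and w: "\<forall>i<r. w i > 0" and \<sigma>0: "\<sigma>0 > real r - 1" and c: "c > 0"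
  shows "\<exists>K\<ge>0. \<forall>y s. y > 0 \<longrightarrow> \<sigma>0 \<le> Re s \<longrightarrow> \<bar>Im s\<bar> \<ge> c * y \<longrightarrow>
     norm (barnes_main r y w s) \<le> K * y powr (real r - 1 - Re s)"
proof -
  define \<rho> where "\<rho> = (\<sigma>0 - (real r - 1)) ^ (r - 1)"
  define W where "W = (\<Prod>i<r. w i)"
  have \<rho>: "\<rho> > 0" using \<sigma>0 by (simp add: \<rho>_def)
  have W: "W > 0" using w by (auto simp: W_def intro: prod_pos)
  show ?thesis
  proof (intro exI[of _ "1 / (\<rho> * c * W)"] conjI allI impI)
    fix y s assume y: "y > 0" and s: "\<sigma>0 \<le> Re s" and t: "\<bar>Im s\<bar> \<ge> c * y"
    have "c * y \<le> norm (s - of_nat r)" using t abs_Im_le_cmod[of "s - of_nat r"] by simp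
    then have "\<rho> * (c * y) \<le> \<rho> * norm (s - of_nat r)" using \<rho> by simp
    also have "\<dots> \<le> norm (\<Prod>k=1..r. (s - of_nat k))"
      unfolding \<rho>_def by (rule norm_prod_poles_ge[OF r s \<sigma>0])
    finally have P: "\<rho> * (c * y) \<le> norm (\<Prod>k=1..r. (s - of_nat k))" .
    have "norm (barnes_main r y w s) = y powr (real r - Re s) / (norm (\<Prod>k=1..r. (s - of_nat k)) * W)"
      using y W unfolding barnes_main_def W_def[symmetric]
      by (simp only: norm_divide norm_mult norm_of_real_powr norm_of_real) simp
    also have "\<dots> \<le> y powr (real r - Re s) / (\<rho> * (c * y) * W)"
    proof (rule divide_left_mono)
      have pos: "\<rho> * (c * y) > 0" using \<rho> c y by simp
      show "0 < norm (\<Prod>k=1..r. (s - of_nat k)) * W * (\<rho> * (c * y) * W)"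
        by (intro mult_pos_pos less_le_trans[OF pos P] pos W)
      show "\<rho> * (c * y) * W \<le> norm (\<Prod>k=1..r. (s - of_nat k)) * W"
        by (rule mult_right_mono[OF P less_imp_le[OF W]])
    qed simp
    also have "y powr (real r - Re s) = y powr (real r - 1 - Re s) * y"
      using y powr_add[of y "real r - 1 - Re s" 1] by simp
    finally show "norm (barnes_main r y w s) \<le> 1 / (\<rho> * c * W) * y powr (real r - 1 - Re s)"
      using y by (simp add: mult_ac)
  qed (use \<rho> c W in simp)
qed

text \<open>Differentiating \<open>y powr (of_nat r - s)\<close> produces the factor
  \<open>of_nat r - s\<close>, which cancels the only small factor of the denominator. The bound is
  thus uniform up to the pole at \<open>r\<close>.\<close>

lemma norm_barnes_main_diff_le:
  assumes r: "r \<ge> 1" and w: "\<forall>i<r. w i > 0" and \<sigma>0: "\<sigma>0 > real r - 1"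
  shows "\<exists>K\<ge>0. \<forall>y y' s. 0 < y \<longrightarrow> y \<le> y' \<longrightarrow> \<sigma>0 \<le> Re s \<longrightarrow> s \<notin> barnes_poles r \<longrightarrow>
     norm (barnes_main r y' w s - barnes_main r y w s) \<le> K * (y' - y) * y powr (real r - 1 - Re s)"
proof -
  define \<rho> where "\<rho> = (\<sigma>0 - (real r - 1)) ^ (r - 1)"
  define W where "W = (\<Prod>i<r. w i)"
  have \<rho>: "\<rho> > 0" using \<sigma>0 by (simp add: \<rho>_def)
  have W: "W > 0" using w by (auto simp: W_def intro: prod_pos)
  show ?thesis
  proof (intro exI[of _ "1 / (\<rho> * W)"] conjI allI impI)
    fix y y' :: real and s assume y: "0 < y" "y \<le> y'" and s: "\<sigma>0 \<le> Re s" and sp: "s \<notin> barnes_poles r"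
    define n where "n = norm (s - of_nat r)"
    define P where "P = (\<Prod>k=1..r. (s - of_nat k))"
    have n: "n > 0"
      using sp r by (auto simp: n_def barnes_poles_def)
    have P: "\<rho> * n \<le> norm P"
      unfolding \<rho>_def n_def P_def by (rule norm_prod_poles_ge[OF r s \<sigma>0])
    have "norm (complex_of_real y' powr (of_nat r - s) - complex_of_real y powr (of_nat r - s))
        \<le> n * y powr (real r - 1 - Re s) * norm (complex_of_real y' - of_real y)"
    proof (rule field_differentiable_bound[of "closed_segment (complex_of_real y) (of_real y')"])
      fix z assume "z \<in> closed_segment (complex_of_real y) (of_real y')"
      then obtain \<xi> where xi: "z = of_real \<xi>" "y \<le> \<xi>"
        using y unfolding closed_segment_of_real by (auto simp: closed_segment_eq_real_ivl)
      have "z \<notin> \<real>\<^sub>\<le>\<^sub>0" using xi y by (auto simp: complex_nonpos_Reals_iff)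
      then show "((\<lambda>z. z powr (of_nat r - s)) has_field_derivative (of_nat r - s) * z powr (of_nat r - s - 1))
          (at z within closed_segment (complex_of_real y) (of_real y'))"
        by (intro has_field_derivative_at_within[OF has_field_derivative_powr])
      have "norm ((of_nat r - s) * z powr (of_nat r - s - 1)) = n * \<xi> powr (real r - 1 - Re s)"
      proof -
        have "real r - 1 - Re s = real r - Re s - 1" by simp
        then show ?thesis
          using xi y by (simp only: norm_mult n_def norm_minus_commute[of s]) (simp add: norm_of_real_powr)
      qed
      also have "\<dots> \<le> n * y powr (real r - 1 - Re s)"
        using xi y s \<sigma>0 n by (intro mult_left_mono powr_mono2') auto
      finally show "norm ((of_nat r - s) * z powr (of_nat r - s - 1)) \<le> n * y powr (real r - 1 - Re s)" .
    qed auto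
    also have "norm (complex_of_real y' - of_real y) = y' - y"
      using y by (simp flip: of_real_diff)
    finally have D: "norm (complex_of_real y' powr (of_nat r - s) - complex_of_real y powr (of_nat r - s))
        \<le> n * y powr (real r - 1 - Re s) * (y' - y)" .
    have "norm (barnes_main r y' w s - barnes_main r y w s) =
       norm (complex_of_real y' powr (of_nat r - s) - complex_of_real y powr (of_nat r - s)) / (norm P * W)"
      using W unfolding barnes_main_def W_def[symmetric] P_def[symmetric] diff_divide_distrib[symmetric]
      by (simp only: norm_divide norm_mult norm_of_real abs_of_pos)
    also have "\<dots> \<le> n * y powr (real r - 1 - Re s) * (y' - y) / (\<rho> * n * W)"
      using D P \<rho> n W y by (intro frac_le mult_right_mono mult_pos_pos mult_nonneg_nonneg) auto
    also have "\<dots> = 1 / (\<rho> * W) * (y' - y) * y powr (real r - 1 - Re s)"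
      using n by (simp add: mult_ac)
    finally show "norm (barnes_main r y' w s - barnes_main r y w s)
      \<le> 1 / (\<rho> * W) * (y' - y) * y powr (real r - 1 - Re s)" .
  qed (use \<rho> W in simp)
qed

section \<open>Sums over a box of side of order \<open>y\<close>\<close>

lemma card_barnes_box_slice_le:
  fixes L :: nat
  assumes i: "i < r"
  defines "B \<equiv> {m \<in> barnes_idx r. m i = 0 \<and> (\<forall>j<r. j \<noteq> i \<longrightarrow> m j < L)}"
  shows "card B \<le> L ^ (r - 1)"
proof -
  define J where "J = {..<r} - {i}"
  have fin: "finite (J \<rightarrow>\<^sub>E {..<L})" by (auto simp: J_def intro!: finite_PiE)
  have inj: "inj_on (\<lambda>m. restrict m J) B"
  proof (rule inj_onI)
    fix m m' assume m: "m \<in> B" "m' \<in> B" "restrict m J = restrict m' J"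
    show "m = m'"
    proof
      fix j
      consider "j \<in> J" | "j = i" | "j \<ge> r" by (force simp: J_def)
      then show "m j = m' j"
      proof cases
        case 1
        then show ?thesis using m(3) by (metis restrict_apply')
      qed (use m in \<open>auto simp: B_def barnes_idx_def\<close>)
    qed
  qed
  have sub: "(\<lambda>m. restrict m J) ` B \<subseteq> J \<rightarrow>\<^sub>E {..<L}"
    by (auto simp: B_def J_def split: if_splits)
  have "card B \<le> card (J \<rightarrow>\<^sub>E {..<L})" by (rule card_inj_on_le[OF inj sub fin])
  also have "\<dots> = L ^ (r - 1)" using i by (simp add: J_def card_PiE)
  finally show "card B \<le> L ^ (r - 1)" .
qed

lemma barnes_box_sum_split:
  fixes L :: nat and f :: "real \<Rightarrow> complex"
  assumes i: "i < r"
  shows "(\<Sum>m\<in>{m \<in> barnes_idx r. \<forall>j<r. m j < L}. f (barnes_lin r w m)) =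
    (\<Sum>m\<in>{m \<in> barnes_idx r. m i = 0 \<and> (\<forall>j<r. j \<noteq> i \<longrightarrow> m j < L)}. \<Sum>n<L. f (barnes_lin r w m + real n * w i))"
proof -
  define B where "B = {m \<in> barnes_idx r. m i = 0 \<and> (\<forall>j<r. j \<noteq> i \<longrightarrow> m j < L)}"
  have lin: "barnes_lin r w (m(i := n)) = barnes_lin r w m + real n * w i" if "m i = 0" for m n
  proof -
    have "barnes_lin r w m' = real (m' i) * w i + (\<Sum>j\<in>{..<r} - {i}. real (m' j) * w j)" for m'
      unfolding barnes_lin_def using i by (subst sum.remove[of _ i]) auto
    moreover have "(\<Sum>j\<in>{..<r} - {i}. real ((m(i := n)) j) * w j) = (\<Sum>j\<in>{..<r} - {i}. real (m j) * w j)"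
      by (intro sum.cong) auto
    ultimately show ?thesis using that by simp
  qed
  have "(\<Sum>m\<in>{m \<in> barnes_idx r. \<forall>j<r. m j < L}. f (barnes_lin r w m)) =
     (\<Sum>(m, n)\<in>B \<times> {..<L}. f (barnes_lin r w m + real n * w i))"
    by (rule sum.reindex_bij_witness[of _ "\<lambda>(m, n). m(i := n)" "\<lambda>m. (m(i := 0), m i)"])
       (use i in \<open>auto simp: B_def barnes_idx_def lin[symmetric]\<close>)
  also have "\<dots> = (\<Sum>m\<in>B. \<Sum>n<L. f (barnes_lin r w m + real n * w i))"
    by (rule sum.cartesian_product[symmetric])
  finally show ?thesis unfolding B_def .
qed

text \<open>The box is cut into lines in direction \<open>i\<close>. On a line the integral part is
  of order \<open>y powr (1 - Re s)\<close> divided by \<open>Im s\<close>, hence of order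
  \<open>y powr (- Re s)\<close>, and so is the remainder. There are at most
  \<open>L ^ (r - 1)\<close> lines, bounded trivially.\<close>

lemma norm_barnes_box_sum_le:
  fixes y0 \<sigma>0 \<sigma>1 C c A :: real
  assumes w: "\<forall>i<r. w i > 0" and i: "i < r" and y0: "y0 > 0" and \<sigma>0: "\<sigma>0 > 0" and C: "C > 1"
    and c: "c > 0" and A: "A > 0"
  shows "\<exists>K\<ge>0. \<forall>y s (L::nat). y \<ge> y0 \<longrightarrow> \<sigma>0 \<le> Re s \<longrightarrow> Re s \<le> \<sigma>1 \<longrightarrow> \<bar>Im s\<bar> * w i \<le> 2 * pi * y / C \<longrightarrow>
     \<bar>Im s\<bar> \<ge> c * y \<longrightarrow> real L \<le> A * y \<longrightarrow>
     norm (\<Sum>m\<in>{m \<in> barnes_idx r. \<forall>j<r. m j < L}. complex_of_real (y + barnes_lin r w m) powr (-s))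
       \<le> K * y powr (real r - 1 - Re s)"
proof -
  define v where "v = w i"
  have v: "v > 0" using w i by (simp add: v_def)
  define W where "W = (\<Sum>j<r. w j)"
  have W: "W \<ge> v"
    unfolding v_def W_def by (rule member_le_sum) (use w i in \<open>auto intro: less_imp_le\<close>)
  \<comment> \<open>Both the base point of a line and its length add at most
    \<open>A * y * W\<close>, so every point of it stays below \<open>D * y\<close>.\<close>
  define D where "D = 1 + 2 * A * W"
  have D: "D \<ge> 1" using A W v by (simp add: D_def)
  obtain K1 where K1: "K1 \<ge> 0" and K1b: "\<And>y s N. y \<ge> y0 \<Longrightarrow> \<sigma>0 \<le> Re s \<Longrightarrow> Re s \<le> \<sigma>1 \<Longrightarrow>
      \<bar>Im s\<bar> * v \<le> 2 * pi * y / C \<Longrightarrow> s \<noteq> 1 \<Longrightarrow>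
      norm (\<Sum>n<N. powr_taylor_rem 2 v (y + real n * v) s / (of_real v * (s - 1))) \<le> K1 * y powr (- Re s)"
    using norm_powr_taylor_rem_sum_le[OF v y0 C \<sigma>0, of \<sigma>1] by blast
  define K3 where "K3 = 2 * D / (v * c) + K1"
  have K3: "K3 \<ge> 0" using D v c K1 by (simp add: K3_def)
  show ?thesis
  proof (intro exI[of _ "A ^ (r - 1) * K3"] conjI allI impI)
    fix y s and L :: nat
    assume y: "y \<ge> y0" and \<sigma>: "\<sigma>0 \<le> Re s" "Re s \<le> \<sigma>1" and t: "\<bar>Im s\<bar> * w i \<le> 2 * pi * y / C"
      and tc: "\<bar>Im s\<bar> \<ge> c * y" and L: "real L \<le> A * y"
    have ypos: "y > 0" using y y0 by simp
    have s1: "s \<noteq> 1"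
    proof
      assume "s = 1"
      then show False using tc mult_pos_pos[OF c ypos] by simp
    qed
    define B where "B = {m \<in> barnes_idx r. m i = 0 \<and> (\<forall>j<r. j \<noteq> i \<longrightarrow> m j < L)}"
    have inner: "norm (\<Sum>n<L. complex_of_real (y + (barnes_lin r w m + real n * w i)) powr (-s))
        \<le> K3 * y powr (- Re s)" if m: "m \<in> B" for m
    proof -
      define Y where "Y = y + barnes_lin r w m"
      have Y: "Y \<ge> y" using barnes_lin_nonneg[OF w, of m] by (simp add: Y_def)
      have Ypos: "Y > 0" using Y ypos by simp
      have "barnes_lin r w m \<le> (\<Sum>j<r. real L * w j)"
        unfolding barnes_lin_def
      proof (intro sum_mono mult_right_mono)
        fix j assume j: "j \<in> {..<r}"
        then show "real (m j) \<le> real L" using m by (cases "j = i") (auto simp: B_def intro: less_imp_le)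
        show "w j \<ge> 0" using w j by (auto intro: less_imp_le)
      qed
      also have "\<dots> = real L * W" by (simp add: W_def sum_distrib_left)
      finally have "Y + real L * v \<le> y + real L * W + real L * W"
        using mult_left_mono[OF W, of "real L"] unfolding Y_def by linarith
      also have "\<dots> \<le> y + (A * y) * W + (A * y) * W"
        using L W v by (intro add_mono mult_right_mono) auto
      finally have YL: "Y + real L * v \<le> D * y" by (simp add: D_def algebra_simps)
      define Z where "Z = (\<lambda>n. Y + real n * v)"
      have Zy: "Z n \<ge> y" "Z n > 0" for n using Y ypos v by (auto simp: Z_def add_pos_nonneg add_increasing2)
      have ZS: "Z n + v = Z (Suc n)" for n by (simp add: Z_def algebra_simps)
      have bd: "norm (complex_of_real (Z n) powr (1 - s)) \<le> D * y * y powr (- Re s)" if "n \<le> L" for n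
      proof -
        have "Z n \<le> Y + real L * v" using that v by (simp add: Z_def mult_right_mono)
        then have "Z n \<le> D * y" using YL by simp
        moreover have "Z n powr (- Re s) \<le> y powr (- Re s)"
          using Zy(1)[of n] ypos \<sigma> \<sigma>0 by (intro powr_mono2') auto
        ultimately have "Z n * Z n powr (- Re s) \<le> D * y * y powr (- Re s)"
          using Zy(2)[of n] by (intro mult_mono) auto
        moreover have "Z n powr (1 - Re s) = Z n * Z n powr (- Re s)"
          using Zy(2)[of n] powr_add[of "Z n" 1 "- Re s"] by simp
        ultimately show ?thesis using Zy(2)[of n] by (simp add: norm_of_real_powr)
      qed
      define d where "d = complex_of_real v * (s - 1)"
      have d: "d \<noteq> 0" using v s1 by (simp add: d_def)
      have nd: "norm d \<ge> v * (c * y)"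
        using tc abs_Im_le_cmod[of "s - 1"] v by (simp add: d_def norm_mult)
      \<comment> \<open>Each summand is its step average, written as a difference that telescopes,
        plus the Taylor remainder.\<close>
      have "complex_of_real (Z n) powr (-s) = (complex_of_real (Z n) powr (1 - s) - complex_of_real (Z (Suc n)) powr (1 - s)) / d
          + powr_taylor_rem 2 v (Z n) s / d" for n
        using d unfolding powr_taylor_rem_2 ZS d_def[symmetric] by (simp add: field_simps)
      then have "(\<Sum>n<L. complex_of_real (Z n) powr (-s)) =
         (\<Sum>n<L. complex_of_real (Z n) powr (1 - s) - complex_of_real (Z (Suc n)) powr (1 - s)) / d
          + (\<Sum>n<L. powr_taylor_rem 2 v (Z n) s / d)"
        by (simp add: sum.distrib sum_divide_distrib)
      also have "(\<Sum>n<L. complex_of_real (Z n) powr (1 - s) - complex_of_real (Z (Suc n)) powr (1 - s))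
          = complex_of_real (Z 0) powr (1 - s) - complex_of_real (Z L) powr (1 - s)"
        by (rule sum_lessThan_telescope')
      finally have eq: "(\<Sum>n<L. complex_of_real (Z n) powr (-s)) =
         (complex_of_real (Z 0) powr (1 - s) - complex_of_real (Z L) powr (1 - s)) / d
          + (\<Sum>n<L. powr_taylor_rem 2 v (Z n) s / d)" .
      have b1: "norm ((complex_of_real (Z 0) powr (1 - s) - complex_of_real (Z L) powr (1 - s)) / d)
          \<le> 2 * D / (v * c) * y powr (- Re s)"
      proof -
        have "norm (complex_of_real (Z 0) powr (1 - s) - complex_of_real (Z L) powr (1 - s))
           \<le> D * y * y powr (- Re s) + D * y * y powr (- Re s)"
          by (intro order_trans[OF norm_triangle_ineq4] add_mono bd) auto
        then have "norm ((complex_of_real (Z 0) powr (1 - s) - complex_of_real (Z L) powr (1 - s)) / d)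
          \<le> (D * y * y powr (- Re s) + D * y * y powr (- Re s)) / (v * (c * y))"
          unfolding norm_divide using nd v c ypos D by (intro frac_le) auto
        also have "\<dots> = 2 * D / (v * c) * y powr (- Re s)"
          using v c ypos by (simp add: field_simps)
        finally show ?thesis .
      qed
      have b2: "norm (\<Sum>n<L. powr_taylor_rem 2 v (Z n) s / d) \<le> K1 * y powr (- Re s)"
      proof -
        have "\<bar>Im s\<bar> * v \<le> 2 * pi * Y / C"
        proof -
          have "2 * pi * y / C \<le> 2 * pi * Y / C" using Y C by (intro divide_right_mono mult_left_mono) auto
          then show ?thesis using t by (simp add: v_def)
        qed
        then have "norm (\<Sum>n<L. powr_taylor_rem 2 v (Z n) s / d) \<le> K1 * Y powr (- Re s)"
          unfolding Z_def d_def using Y y by (intro K1b \<sigma> s1) auto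
        also have "\<dots> \<le> K1 * y powr (- Re s)"
          using Y ypos \<sigma> \<sigma>0 K1 by (intro mult_left_mono powr_mono2') auto
        finally show ?thesis .
      qed
      have "norm (\<Sum>n<L. complex_of_real (Z n) powr (-s)) \<le> K3 * y powr (- Re s)"
        unfolding eq K3_def distrib_right by (intro norm_triangle_mono b1 b2)
      then show ?thesis by (simp add: Z_def Y_def v_def add.assoc)
    qed
    have "norm (\<Sum>m\<in>{m \<in> barnes_idx r. \<forall>j<r. m j < L}. complex_of_real (y + barnes_lin r w m) powr (-s))
      \<le> (\<Sum>m\<in>B. K3 * y powr (- Re s))"
      unfolding barnes_box_sum_split[OF i, where f = "\<lambda>l. complex_of_real (y + l) powr (-s)"] B_def[symmetric]
      by (intro sum_norm_le inner)
    also have "\<dots> = real (card B) * (K3 * y powr (- Re s))" by simp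
    also have "\<dots> \<le> (A * y) ^ (r - 1) * (K3 * y powr (- Re s))"
    proof (intro mult_right_mono)
      have "card B \<le> L ^ (r - 1)"
        unfolding B_def by (rule card_barnes_box_slice_le[OF i])
      then have "real (card B) \<le> real L ^ (r - 1)"
        by (simp only: of_nat_power[symmetric] of_nat_le_iff)
      also have "\<dots> \<le> (A * y) ^ (r - 1)" using L by (intro power_mono) auto
      finally show "real (card B) \<le> (A * y) ^ (r - 1)" .
    qed (use K3 in simp)
    also have "\<dots> = A ^ (r - 1) * K3 * (y powr real (r - 1) * y powr (- Re s))"
      using ypos by (simp add: power_mult_distrib powr_realpow mult_ac)
    also have "y powr real (r - 1) * y powr (- Re s) = y powr (real r - 1 - Re s)"
      using i by (simp add: of_nat_diff flip: powr_add)
    finally show "norm (\<Sum>m\<in>{m \<in> barnes_idx r. \<forall>j<r. m j < L}. complex_of_real (y + barnes_lin r w m) powr (-s))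
       \<le> A ^ (r - 1) * K3 * y powr (real r - 1 - Re s)" .
  qed (use A K3 in simp)
qed

text \<open>Only the direction \<open>i\<close> has to avoid resonance: it controls the box sum,
  while all shifted points already belong to the low-frequency range.\<close>

lemma barnes_zeta_asymptotic:
  fixes y0 \<sigma>0 \<sigma>1 C :: real
  assumes r: "r \<ge> 1" and w: "\<forall>i<r. w i > 0" and y0: "y0 > 0" and \<sigma>0: "\<sigma>0 > real r - 1" and C: "C > 1"
    and i: "i < r"
  shows "\<exists>K\<ge>0. \<forall>y s. y \<ge> y0 \<longrightarrow> \<sigma>0 \<le> Re s \<longrightarrow> Re s \<le> \<sigma>1 \<longrightarrow> \<bar>Im s\<bar> * w i \<le> 2 * pi * y / C \<longrightarrow>
    s \<notin> barnes_poles r \<longrightarrow>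
    norm (barnes_zeta r y w s - barnes_main r y w s) \<le> K * y powr (real r - 1 - Re s)"
proof -
  have \<sigma>pos: "\<sigma>0 > 0" using \<sigma>0 r by linarith
  define W where "W = (\<Sum>j<r. w j)"
  define u where "u = Min (w ` {..<r})"
  have wW: "w j \<le> W" if "j < r" for j
    unfolding W_def by (rule member_le_sum) (use w that in \<open>auto intro: less_imp_le\<close>)
  have ne: "{..<r} \<noteq> {}" using i by auto
  have u: "u > 0" using w ne by (simp add: u_def)
  have uw: "u \<le> w j" if "j < r" for j using that by (simp add: u_def)
  have vi: "w i > 0" and W: "W > 0" using w i wW[OF i] by auto
  \<comment> \<open>Every \<open>w j\<close> is at most \<open>W\<close>, so
    \<open>\<bar>Im s\<bar> \<le> c * Y\<close> puts \<open>Y\<close> into the low-frequency range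
    in all directions at once.\<close>
  define c where "c = pi / W"
  have c: "c > 0" using W by (simp add: c_def)
  \<comment> \<open>Chosen so that a shift by at least \<open>A0 * y\<close> steps, each of length
    at least \<open>u\<close>, outweighs the frequency bound
    \<open>2 * pi * y / w i\<close>.\<close>
  define A0 where "A0 = 2 * pi / (w i * c * u)"
  \<comment> \<open>The summand \<open>1 / y0\<close> absorbs rounding up to an integer, because
    \<open>1 \<le> y / y0\<close>.\<close>
  define A where "A = A0 + 1 / y0"
  have A0: "A0 > 0" using vi c u by (simp add: A0_def)
  have A: "A > 0" using A0 y0 by (simp add: A_def add_pos_pos)
  \<comment> \<open>Shifted points stay below \<open>D * y\<close>. There the frequency is still at
    least \<open>c / D\<close> times the point, so their main terms lie within the error.\<close>
  define D where "D = 1 + A * W"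
  have D: "D > 0" using A W by (simp add: D_def add_pos_pos)
  obtain K1 where K1: "K1 \<ge> 0" and K1b: "\<And>y s. y \<ge> y0 \<Longrightarrow> \<sigma>0 \<le> Re s \<Longrightarrow> Re s \<le> \<sigma>1 \<Longrightarrow>
      (\<forall>i<r. \<bar>Im s\<bar> * w i \<le> pi * y) \<Longrightarrow> s \<notin> barnes_poles r \<Longrightarrow>
      norm (barnes_zeta r y w s - barnes_main r y w s) \<le> K1 * y powr (real r - 1 - Re s)"
    using barnes_zeta_low_frequency[OF r w y0 \<sigma>0, of \<sigma>1] by blast
  obtain K2 where K2: "K2 \<ge> 0" and K2b: "\<And>y s. y > 0 \<Longrightarrow> \<sigma>0 \<le> Re s \<Longrightarrow> \<bar>Im s\<bar> \<ge> c / D * y \<Longrightarrow>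
      norm (barnes_main r y w s) \<le> K2 * y powr (real r - 1 - Re s)"
    using norm_barnes_main_le[OF r w \<sigma>0, of "c / D"] c D by auto
  obtain K3 where K3: "K3 \<ge> 0" and K3b: "\<And>y s (L::nat). y \<ge> y0 \<Longrightarrow> \<sigma>0 \<le> Re s \<Longrightarrow> Re s \<le> \<sigma>1 \<Longrightarrow>
      \<bar>Im s\<bar> * w i \<le> 2 * pi * y / C \<Longrightarrow> \<bar>Im s\<bar> \<ge> c * y \<Longrightarrow> real L \<le> A * y \<Longrightarrow>
     norm (\<Sum>m\<in>{m \<in> barnes_idx r. \<forall>j<r. m j < L}. complex_of_real (y + barnes_lin r w m) powr (-s))
       \<le> K3 * y powr (real r - 1 - Re s)"
    using norm_barnes_box_sum_le[OF w i y0 \<sigma>pos C c A, of \<sigma>1] by blast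
  define F where "F = {I. I \<subseteq> {..<r} \<and> I \<noteq> {}}"
  define K where "K = K3 + real (card F) * (K1 + K2) + K2 + K1"
  show ?thesis
  proof (intro exI[of _ K] conjI allI impI)
    show "K \<ge> 0" using K1 K2 K3 by (simp add: K_def)
    fix y s assume y: "y \<ge> y0" and \<sigma>: "\<sigma>0 \<le> Re s" "Re s \<le> \<sigma>1"
      and t: "\<bar>Im s\<bar> * w i \<le> 2 * pi * y / C" and s: "s \<notin> barnes_poles r"
    have ypos: "y > 0" using y y0 by simp
    define e where "e = real r - 1 - Re s"
    have e: "e \<le> 0" using \<sigma> \<sigma>0 by (simp add: e_def)
    have low: "\<forall>j<r. \<bar>Im s\<bar> * w j \<le> pi * Y" if "\<bar>Im s\<bar> \<le> c * Y" for Y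
    proof (intro allI impI)
      fix j assume "j < r"
      then have "\<bar>Im s\<bar> * w j \<le> \<bar>Im s\<bar> * W" by (intro mult_left_mono wW) auto
      also have "\<dots> \<le> c * Y * W" using that W by (intro mult_right_mono) auto
      also have "\<dots> = pi * Y" using W by (simp add: c_def)
      finally show "\<bar>Im s\<bar> * w j \<le> pi * Y" .
    qed
    show "norm (barnes_zeta r y w s - barnes_main r y w s) \<le> K * y powr (real r - 1 - Re s)"
    proof (cases "\<bar>Im s\<bar> \<le> c * y")
      case True
      have "norm (barnes_zeta r y w s - barnes_main r y w s) \<le> K1 * y powr (real r - 1 - Re s)"
        by (rule K1b[OF y \<sigma> low[OF True] s])
      also have "\<dots> \<le> K * y powr (real r - 1 - Re s)"
        using K1 K2 K3 by (intro mult_right_mono) (auto simp: K_def)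
      finally show ?thesis .
    next
      case False
      then have tc: "\<bar>Im s\<bar> \<ge> c * y" by simp
      define L where "L = nat \<lceil>A0 * y\<rceil>"
      have L1: "real L \<ge> A0 * y" unfolding L_def by linarith
      have "real L \<le> A0 * y + 1"
        unfolding L_def using mult_pos_pos[OF A0 ypos] by linarith
      also have "1 \<le> y / y0" using y y0 by simp
      finally have L2: "real L \<le> A * y" by (simp add: A_def algebra_simps)
      have tL: "\<bar>Im s\<bar> \<le> c * (real L * u)"
      proof -
        have "\<bar>Im s\<bar> * w i \<le> 2 * pi * y / 1"
          using t C ypos by (intro order_trans[OF t divide_left_mono]) auto
        then have "\<bar>Im s\<bar> \<le> 2 * pi * y / w i" using vi by (simp add: pos_le_divide_eq)
        also have "\<dots> = c * (A0 * y * u)" using vi c u by (simp add: A0_def)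
        also have "\<dots> \<le> c * (real L * u)" using L1 c u by simp
        finally show ?thesis .
      qed
      have M0: "norm (barnes_main r Y w s) \<le> K2 * y powr e" if Y: "y \<le> Y" "Y \<le> D * y" for Y
      proof -
        have "c / D * Y \<le> c / D * (D * y)" using Y c D by (intro mult_left_mono) auto
        also have "\<dots> = c * y" using D by simp
        also note tc
        finally have "norm (barnes_main r Y w s) \<le> K2 * Y powr e"
          unfolding e_def using Y ypos \<sigma> by (intro K2b) auto
        also have "\<dots> \<le> K2 * y powr e" using Y ypos e K2 by (intro mult_left_mono powr_mono2') auto
        finally show ?thesis .
      qed
      \<comment> \<open>After the shift by \<open>L\<close> the point lies in the low-frequency range.\<close>
      have trm: "norm (barnes_zeta r (y + real L * (\<Sum>i\<in>I. w i)) w s) \<le> (K1 + K2) * y powr e"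
        if I: "I \<in> F" for I
      proof -
        define Y where "Y = y + real L * (\<Sum>i\<in>I. w i)"
        obtain j where j: "j \<in> I" "j < r" using I by (auto simp: F_def)
        have "finite I" "I \<subseteq> {..<r}" using I by (auto simp: F_def intro: finite_subset)
        moreover have "w k \<ge> 0" if "k < r" for k using w that by (simp add: less_imp_le)
        ultimately have sI: "w j \<le> (\<Sum>i\<in>I. w i)" "(\<Sum>i\<in>I. w i) \<le> W"
          unfolding W_def using j by (auto intro!: member_le_sum sum_mono2)
        have "real L * u \<le> real L * (\<Sum>i\<in>I. w i)"
          using uw[OF j(2)] sI by (intro mult_left_mono) auto
        then have YL: "real L * u \<le> Y" and Yy: "y \<le> Y"
          using ypos u order_trans[of 0 "real L * u"] by (auto simp: Y_def)
        have "real L * (\<Sum>i\<in>I. w i) \<le> A * y * W"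
          using L2 sI w j A ypos by (intro mult_mono) (auto intro: order_trans[OF less_imp_le])
        then have YD: "Y \<le> D * y" by (simp add: Y_def D_def algebra_simps)
        have "\<bar>Im s\<bar> \<le> c * Y" using tL mult_left_mono[OF YL less_imp_le[OF c]] by linarith
        then have "norm (barnes_zeta r Y w s - barnes_main r Y w s) \<le> K1 * Y powr e"
          unfolding e_def using Yy y by (intro K1b \<sigma> low s) auto
        also have "\<dots> \<le> K1 * y powr e" using Yy ypos e K1 by (intro mult_left_mono powr_mono2') auto
        finally have "norm (barnes_zeta r Y w s) \<le> K1 * y powr e + K2 * y powr e"
          using M0[OF Yy YD] norm_triangle_sub[of "barnes_zeta r Y w s" "barnes_main r Y w s"] by linarith
        then show ?thesis by (simp add: Y_def algebra_simps)
      qed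
      define X where "X = (\<Sum>m\<in>{m \<in> barnes_idx r. \<forall>i<r. m i < L}. complex_of_real (y + barnes_lin r w m) powr (-s))"
      define S where "S = (\<Sum>I\<in>F. (-1) ^ card I * barnes_zeta r (y + real L * (\<Sum>i\<in>I. w i)) w s)"
      have "barnes_zeta r y w s = X - S"
        unfolding X_def S_def F_def by (rule barnes_zeta_box[OF w ypos s])
      then have "norm (barnes_zeta r y w s - barnes_main r y w s) \<le> norm X + norm S + norm (barnes_main r y w s)"
        by (metis norm_triangle_ineq4 norm_triangle_le_diff add_right_mono order_trans)
      moreover have "norm X \<le> K3 * y powr e"
        unfolding X_def e_def by (rule K3b[OF y \<sigma> t tc L2])
      moreover have "norm S \<le> real (card F) * ((K1 + K2) * y powr e)"
        unfolding S_def
      proof (intro sum_norm_bound)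
        fix I assume "I \<in> F"
        then show "norm ((-1) ^ card I * barnes_zeta r (y + real L * (\<Sum>i\<in>I. w i)) w s) \<le> (K1 + K2) * y powr e"
          using trm by (simp add: norm_mult norm_power)
      qed
      moreover have "norm (barnes_main r y w s) \<le> K2 * y powr e"
        using A W ypos by (intro M0) (auto simp: D_def)
      moreover have "0 \<le> K1 * y powr e" using K1 by simp
      moreover have "K * y powr e = K3 * y powr e + real (card F) * ((K1 + K2) * y powr e) + K2 * y powr e + K1 * y powr e"
        by (simp add: K_def algebra_simps)
      ultimately show ?thesis unfolding e_def[symmetric] by linarith
    qed
  qed
qed

section \<open>Assembly of the expansion\<close>

text \<open>The shifted point is at least \<open>x\<close> times the sum of the weights in
  \<open>I\<close>, hence at least \<open>x * w i\<close> for any \<open>i\<close> in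
  \<open>I\<close>. The weight-free bound on \<open>Im s\<close> therefore implies the phase
  condition in direction \<open>i\<close>. The parameter \<open>b\<close> leaves room for the
  integer side of the box, at the cost of moving the main term by a bounded distance.\<close>

lemma barnes_shifted_term_asymptotic:
  fixes a \<sigma>0 \<sigma>1 C :: real
  assumes r: "r \<ge> 1" and w: "\<forall>i<r. w i > 0" and a: "a > 0" and \<sigma>0: "\<sigma>0 > real r - 1" and C: "C > 1"
    and I: "I \<subseteq> {..<r}" "I \<noteq> {}"
  shows "\<exists>K\<ge>0. \<forall>x b s. x \<ge> 1 \<longrightarrow> x \<le> b \<longrightarrow> b \<le> x + 1 \<longrightarrow> \<sigma>0 \<le> Re s \<longrightarrow> Re s \<le> \<sigma>1 \<longrightarrow>
    \<bar>Im s\<bar> \<le> 2 * pi * x / C \<longrightarrow> s \<notin> barnes_poles r \<longrightarrow>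
    norm (barnes_main r (a + x * (\<Sum>i\<in>I. w i)) w s - barnes_zeta r (a + b * (\<Sum>i\<in>I. w i)) w s)
      \<le> K * x powr (real r - 1 - Re s)"
proof -
  define v where "v = (\<Sum>i\<in>I. w i)"
  obtain i where i: "i \<in> I" "i < r" using I by auto
  have fin: "finite I" using I by (auto intro: finite_subset)
  have wv: "w i \<le> v" unfolding v_def using I w i fin by (intro member_le_sum) (auto intro: less_imp_le)
  have wi: "w i > 0" using w i by simp
  have v: "v > 0" using wi wv by linarith
  obtain K1 where K1: "K1 \<ge> 0" and K1b: "\<And>y s. y \<ge> a \<Longrightarrow> \<sigma>0 \<le> Re s \<Longrightarrow> Re s \<le> \<sigma>1 \<Longrightarrow>
    \<bar>Im s\<bar> * w i \<le> 2 * pi * y / C \<Longrightarrow> s \<notin> barnes_poles r \<Longrightarrow>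
    norm (barnes_zeta r y w s - barnes_main r y w s) \<le> K1 * y powr (real r - 1 - Re s)"
    using barnes_zeta_asymptotic[OF r w a \<sigma>0 C i(2), of \<sigma>1] by blast
  obtain K2 where K2: "K2 \<ge> 0" and K2b: "\<And>y y' s. 0 < y \<Longrightarrow> y \<le> y' \<Longrightarrow> \<sigma>0 \<le> Re s \<Longrightarrow> s \<notin> barnes_poles r \<Longrightarrow>
     norm (barnes_main r y' w s - barnes_main r y w s) \<le> K2 * (y' - y) * y powr (real r - 1 - Re s)"
    using norm_barnes_main_diff_le[OF r w \<sigma>0] by blast
  \<comment> \<open>Dominates \<open>v powr e\<close> for every exponent \<open>e\<close> that
    occurs, turning powers of \<open>x * v\<close> into powers of \<open>x\<close>.\<close>
  define E where "E = v powr (real r - 1 - \<sigma>1) + v powr (real r - 1 - \<sigma>0)"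
  have E: "E \<ge> 0" by (simp add: E_def)
  show ?thesis
  proof (intro exI[of _ "(K2 * v + K1) * E"] conjI allI impI)
    show "(K2 * v + K1) * E \<ge> 0" using K1 K2 v E by simp
    fix x b s assume x: "x \<ge> 1" and b: "x \<le> b" "b \<le> x + 1" and \<sigma>: "\<sigma>0 \<le> Re s" "Re s \<le> \<sigma>1"
      and t: "\<bar>Im s\<bar> \<le> 2 * pi * x / C" and s: "s \<notin> barnes_poles r"
    define e where "e = real r - 1 - Re s"
    have e: "e \<le> 0" using \<sigma> \<sigma>0 by (simp add: e_def)
    define y where "y = a + x * v"
    define y' where "y' = a + b * v"
    have xv: "x * v > 0" using x v by simp
    have yy': "y \<le> y'" using b v by (simp add: y_def y'_def)
    have d: "y' - y \<le> v"
    proof -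
      have "y' - y = (b - x) * v" by (simp add: y_def y'_def algebra_simps)
      also have "\<dots> \<le> 1 * v" using b v by (intro mult_right_mono) auto
      finally show ?thesis by simp
    qed
    have ye: "Y powr e \<le> E * x powr e" if "y \<le> Y" for Y
    proof -
      have "Y powr e \<le> (x * v) powr e"
        using that a xv e by (intro powr_mono2') (auto simp: y_def)
      also have "\<dots> = v powr e * x powr e" by (simp add: powr_mult)
      also have "v powr e \<le> E"
        unfolding E_def e_def using v \<sigma> by (intro powr_le_endpoints) auto
      finally show ?thesis by (simp add: mult_right_mono)
    qed
    have "\<bar>Im s\<bar> * w i \<le> 2 * pi * x / C * v"
      using t wv wi by (intro mult_mono) (auto intro: order_trans[OF abs_ge_zero])
    also have "\<dots> \<le> 2 * pi * y' / C"
    proof -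
      have "x * v \<le> y'" using yy' a by (simp add: y_def)
      then have "2 * pi * (x * v) / C \<le> 2 * pi * y' / C" using C by (intro divide_right_mono mult_left_mono) auto
      then show ?thesis by (simp add: mult.assoc)
    qed
    finally have t': "\<bar>Im s\<bar> * w i \<le> 2 * pi * y' / C" .
    have ya: "y > 0" "y' \<ge> a" using a xv yy' by (auto simp: y_def)
    have "norm (barnes_main r y w s - barnes_zeta r y' w s) \<le>
        norm (barnes_main r y' w s - barnes_main r y w s) + norm (barnes_zeta r y' w s - barnes_main r y' w s)"
      using norm_triangle_ineq[of "barnes_main r y' w s - barnes_main r y w s" "barnes_zeta r y' w s - barnes_main r y' w s"]
      by (simp add: norm_minus_commute)
    also have "\<dots> \<le> K2 * (y' - y) * y powr e + K1 * y' powr e"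
      unfolding e_def by (intro add_mono K2b K1b \<sigma> s t' ya yy')
    also have "\<dots> \<le> K2 * v * (E * x powr e) + K1 * (E * x powr e)"
      using d K1 K2 v yy' ye by (intro add_mono mult_mono mult_left_mono) auto
    also have "\<dots> = (K2 * v + K1) * E * x powr e" by (simp add: algebra_simps)
    finally show "norm (barnes_main r (a + x * (\<Sum>i\<in>I. w i)) w s - barnes_zeta r (a + b * (\<Sum>i\<in>I. w i)) w s)
      \<le> (K2 * v + K1) * E * x powr (real r - 1 - Re s)"
      by (simp add: y_def y'_def v_def e_def)
  qed
qed

theorem theorem2:
  fixes r :: nat and a :: real and w :: "nat \<Rightarrow> real" and \<sigma>\<^sub>1 \<sigma>\<^sub>2 C :: real
  assumes "r \<ge> 1" and "a > 0" and "\<forall>i<r. w i > 0"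
    and "real r - 1 < \<sigma>\<^sub>1" and "\<sigma>\<^sub>1 < \<sigma>\<^sub>2" and "C > 1"
  shows "\<exists>K. \<forall>x::real. \<forall>s::complex.
           x \<ge> 1 \<longrightarrow> \<sigma>\<^sub>1 < Re s \<longrightarrow> Re s < \<sigma>\<^sub>2 \<longrightarrow> \<bar>Im s\<bar> \<le> 2 * pi * x / C
           \<longrightarrow> s \<notin> barnes_poles r \<longrightarrow>
           norm (barnes_zeta r a w s
             - (\<Sum>m \<in> {m \<in> barnes_idx r. \<forall>i<r. real (m i) \<le> x}.
                  1 / (complex_of_real (a + barnes_lin r w m) powr s))
             + (\<Sum>I \<in> {I. I \<subseteq> {..<r} \<and> I \<noteq> {}}.
                  (-1) ^ card I * complex_of_real (a + x * (\<Sum>i\<in>I. w i)) powr (of_nat r - s)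
                  / ((\<Prod>k=1..r. (s - of_nat k)) * complex_of_real (\<Prod>i<r. w i))))
           \<le> K * x powr (real r - 1 - Re s)"
proof -
  define F where "F = {I. I \<subseteq> {..<r} \<and> I \<noteq> {}}"
  have "\<forall>I\<in>F. \<exists>K. \<forall>x b s. x \<ge> 1 \<longrightarrow> x \<le> b \<longrightarrow> b \<le> x + 1 \<longrightarrow> \<sigma>\<^sub>1 \<le> Re s \<longrightarrow> Re s \<le> \<sigma>\<^sub>2 \<longrightarrow>
    \<bar>Im s\<bar> \<le> 2 * pi * x / C \<longrightarrow> s \<notin> barnes_poles r \<longrightarrow>
    norm (barnes_main r (a + x * (\<Sum>i\<in>I. w i)) w s - barnes_zeta r (a + b * (\<Sum>i\<in>I. w i)) w s)
      \<le> K * x powr (real r - 1 - Re s)"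
    using barnes_shifted_term_asymptotic[OF assms(1,3,2,4,6)] unfolding F_def by blast
  then obtain K where K: "\<And>I x b s. I \<in> F \<Longrightarrow> x \<ge> 1 \<Longrightarrow> x \<le> b \<Longrightarrow> b \<le> x + 1 \<Longrightarrow> \<sigma>\<^sub>1 \<le> Re s \<Longrightarrow> Re s \<le> \<sigma>\<^sub>2 \<Longrightarrow>
    \<bar>Im s\<bar> \<le> 2 * pi * x / C \<Longrightarrow> s \<notin> barnes_poles r \<Longrightarrow>
    norm (barnes_main r (a + x * (\<Sum>i\<in>I. w i)) w s - barnes_zeta r (a + b * (\<Sum>i\<in>I. w i)) w s)
      \<le> K I * x powr (real r - 1 - Re s)"
    unfolding bchoice_iff by blast
  show ?thesis
  proof (intro exI[of _ "\<Sum>I\<in>F. K I"] allI impI)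
    fix x :: real and s :: complex
    assume x: "x \<ge> 1" and \<sigma>: "\<sigma>\<^sub>1 < Re s" "Re s < \<sigma>\<^sub>2" and t: "\<bar>Im s\<bar> \<le> 2 * pi * x / C"
      and s: "s \<notin> barnes_poles r"
    \<comment> \<open>The number of integers from 0 to \<open>x\<close>: \<open>n < L\<close> means
      \<open>real n \<le> x\<close>, also when \<open>x\<close> is itself an integer, in which case
      \<open>L\<close> equals \<open>x + 1\<close>.\<close>
    define L where "L = nat \<lfloor>x\<rfloor> + 1"
    have L: "x \<le> real L" "real L \<le> x + 1" unfolding L_def using x by linarith+
    have box: "{m \<in> barnes_idx r. \<forall>i<r. real (m i) \<le> x} = {m \<in> barnes_idx r. \<forall>i<r. m i < L}"
    proof -
      have "real n \<le> x \<longleftrightarrow> n < L" for n unfolding L_def using x by linarith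
      then show ?thesis by simp
    qed
    \<comment> \<open>The exact box identity cancels the finite sum, so only main terms minus
      shifted zeta values remain, one for each nonempty \<open>I\<close>.\<close>
    have "barnes_zeta r a w s
             - (\<Sum>m \<in> {m \<in> barnes_idx r. \<forall>i<r. real (m i) \<le> x}.
                  1 / (complex_of_real (a + barnes_lin r w m) powr s))
             + (\<Sum>I \<in> {I. I \<subseteq> {..<r} \<and> I \<noteq> {}}.
                  (-1) ^ card I * complex_of_real (a + x * (\<Sum>i\<in>I. w i)) powr (of_nat r - s)
                  / ((\<Prod>k=1..r. (s - of_nat k)) * complex_of_real (\<Prod>i<r. w i)))
       = (\<Sum>I\<in>F. (-1) ^ card I * barnes_main r (a + x * (\<Sum>i\<in>I. w i)) w s)
         - (\<Sum>I\<in>F. (-1) ^ card I * barnes_zeta r (a + real L * (\<Sum>i\<in>I. w i)) w s)"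
      unfolding box barnes_zeta_box[OF assms(3,2) s, of L] F_def barnes_main_def
      by (simp only: powr_minus divide_inverse mult_1_left mult.assoc) simp
    also have "\<dots> = (\<Sum>I\<in>F. (-1) ^ card I *
        (barnes_main r (a + x * (\<Sum>i\<in>I. w i)) w s - barnes_zeta r (a + real L * (\<Sum>i\<in>I. w i)) w s))"
      by (simp add: sum_subtractf right_diff_distrib)
    also have "norm \<dots> \<le> (\<Sum>I\<in>F. K I * x powr (real r - 1 - Re s))"
    proof (intro sum_norm_le)
      fix I assume "I \<in> F"
      then have "norm (barnes_main r (a + x * (\<Sum>i\<in>I. w i)) w s - barnes_zeta r (a + real L * (\<Sum>i\<in>I. w i)) w s)
        \<le> K I * x powr (real r - 1 - Re s)"
        using K[of I x "real L" s] x L \<sigma> t s by simp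
      then show "norm ((-1) ^ card I *
        (barnes_main r (a + x * (\<Sum>i\<in>I. w i)) w s - barnes_zeta r (a + real L * (\<Sum>i\<in>I. w i)) w s))
        \<le> K I * x powr (real r - 1 - Re s)"
        by (simp add: norm_mult norm_power)
    qed
    finally show "norm (barnes_zeta r a w s
             - (\<Sum>m \<in> {m \<in> barnes_idx r. \<forall>i<r. real (m i) \<le> x}.
                  1 / (complex_of_real (a + barnes_lin r w m) powr s))
             + (\<Sum>I \<in> {I. I \<subseteq> {..<r} \<and> I \<noteq> {}}.
                  (-1) ^ card I * complex_of_real (a + x * (\<Sum>i\<in>I. w i)) powr (of_nat r - s)
                  / ((\<Prod>k=1..r. (s - of_nat k)) * complex_of_real (\<Prod>i<r. w i))))
           \<le> (\<Sum>I\<in>F. K I) * x powr (real r - 1 - Re s)"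
      by (simp only: sum_distrib_right)
  qed
qed

end
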